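(* Let $d,\sigma,q\ge 1$ be integers, $V\ge 0$, $\nu,\mu\in\mathbb{R}$, and let $Q=(Q_1,\dots,Q_q):\mathbb{T}^d\to\mathbb{R}^q$ be smooth. Assume that $$\{\mathbf{1},\ \sin\langle x,k\rangle,\ \cos\langle x,k\rangle \mid k\in K\}\subset \operatorname{span}\{Q_j\mid j=1,\dots,q\},$$ where $K=\{(1,0,\dots,0),(0,1,\dots,0),\dots,(0,\dots,0,1,0),(1,\dots,1)\}\subset\mathbb{Z}^d\setminus\{0\}$. Let $s\ge s_d$ be an integer. Then for any $R\in\mathbb{R}$ the system $$\partial_t\psi=V\psi+(1+i\nu)\Delta\psi-(1+i\mu)|\psi|^{2\sigma}\psi+(1+iR)\langle u(t),Q(x)\rangle\psi,\qquad \psi(0,x)=\psi_0(x),\qquad x\in\mathbb{T}^d,$$ is small-time approximately null-controllable: for every $R\in\mathbb{R}$, $\varepsilon>0$, $T>0$ and $\psi_0\in H^s$, there exists $u\in L^2([0,T];\mathbb{R}^q)$ such that the system has a solution $\psi\in C([0,T];H^s)$ and $$\|\psi(T)\|_{H^s}<\varepsilon.$$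
   Context: $\mathbb{T}^d=\mathbb{R}^d/2\pi\mathbb{Z}^d$; $\langle\cdot,\cdot\rangle$ is the Euclidean scalar product; $\mathbf{1}$ is the function identically equal to $1$ on $\mathbb{T}^d$; $\operatorname{span}$ is the real linear span. $K$ consists of the $d$ vectors $e_1,\dots,e_{d-1}$ (the first $d-1$ standard basis vectors) and $(1,\dots,1)$; for $d=1$, $K=\{1\}$. $s_d$ is the smallest integer strictly greater than $d/2$. $H^s=H^s(\mathbb{T}^d;\mathbb{C})$ with norm $\|f\|_{H^s}^2=\sum_{k\in\mathbb{Z}^d}(1+|k|^2)^s|\widehat f(k)|^2$, where $\widehat f(k)=(2\pi)^{-d}\int_{[0,2\pi]^d}f(x)e^{-i\langle k,x\rangle}\,dx$. Solutions are understood in the mild (Duhamel) sense with respect to the semigroup generated by $V+(1+i\nu)\Delta$. *)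

theory Defs
  imports "HOL-Analysis.Analysis"
begin

section \<open>Functions on the torus\<close>

text \<open>
  A function on the torus \<open>\<real>\<^sup>d / 2\<pi>\<int>\<^sup>d\<close> is a \<open>2\<pi>\<int>\<^sup>d\<close>-periodic function on \<open>real ^ 'd\<close>,
  with \<open>d = CARD('d)\<close>.
\<close>

definition real_vec :: "int ^ 'd \<Rightarrow> real ^ 'd" where
  "real_vec k = (\<chi> i. real_of_int (k $ i))"

definition torus_fun :: "(real ^ 'd \<Rightarrow> 'b) \<Rightarrow> bool" where
  "torus_fun f \<longleftrightarrow> (\<forall>x k. f (x + (2 * pi) *\<^sub>R real_vec k) = f x)"

primrec Ck :: "nat \<Rightarrow> ('a::euclidean_space \<Rightarrow> 'b::real_normed_vector) \<Rightarrow> bool" where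
  "Ck 0 f \<longleftrightarrow> continuous_on UNIV f"
| "Ck (Suc n) f \<longleftrightarrow>
     (\<forall>x. f differentiable (at x)) \<and> (\<forall>v. Ck n (\<lambda>x. frechet_derivative f (at x) v))"

definition smooth :: "('a::euclidean_space \<Rightarrow> 'b::real_normed_vector) \<Rightarrow> bool" where
  "smooth f \<longleftrightarrow> (\<forall>n. Ck n f)"

definition component_span :: "('a \<Rightarrow> real ^ 'q) \<Rightarrow> ('a \<Rightarrow> real) set" where
  "component_span Q = {f. \<exists>c. \<forall>x. f x = (\<Sum>j\<in>UNIV. c j * Q x $ j)}"

text \<open>The order on the index type serves only to single out the last index \<open>Max UNIV\<close>.\<close>

definition freqs :: "(int ^ 'd::{finite,linorder}) set" where
  "freqs = {axis i 1 | i. i \<noteq> Max UNIV} \<union> {\<chi> i. 1}"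


section \<open>Sobolev spaces\<close>

definition torus_cube :: "(real ^ 'd) set" where
  "torus_cube = cbox 0 (\<chi> i. 2 * pi)"

definition fourier_coeff :: "(real ^ 'd \<Rightarrow> complex) \<Rightarrow> int ^ 'd \<Rightarrow> complex" where
  "fourier_coeff f k =
     (LINT x:torus_cube|lborel. f x * exp (- \<i> * of_real (real_vec k \<bullet> x))) / of_real ((2 * pi) ^ CARD('d))"

definition sobolev_term :: "nat \<Rightarrow> (real ^ 'd \<Rightarrow> complex) \<Rightarrow> int ^ 'd \<Rightarrow> real" where
  "sobolev_term s f k = (1 + (norm (real_vec k))\<^sup>2) ^ s * (cmod (fourier_coeff f k))\<^sup>2"

text \<open>
  The elements of \<open>sobolev s\<close> are representatives: two of them stand for the same element of
  \<open>H\<^sup>s\<close> iff they agree almost everywhere, that is, iff \<open>sobolev_norm s\<close> of their difference is 0.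
\<close>

definition sobolev :: "nat \<Rightarrow> (real ^ 'd \<Rightarrow> complex) set" where
  "sobolev s = {f. torus_fun f \<and> f \<in> borel_measurable borel \<and>
     set_integrable lborel torus_cube (\<lambda>x. (cmod (f x))\<^sup>2) \<and>
     sobolev_term s f summable_on UNIV}"

definition sobolev_norm :: "nat \<Rightarrow> (real ^ 'd \<Rightarrow> complex) \<Rightarrow> real" where
  "sobolev_norm s f = sqrt (\<Sum>\<^sub>\<infinity>k. sobolev_term s f k)"

definition crit_index :: "nat \<Rightarrow> nat" where
  "crit_index d = (LEAST n. real n > real d / 2)"

definition sobolev_continuous_on ::
    "nat \<Rightarrow> real set \<Rightarrow> (real \<Rightarrow> real ^ 'd \<Rightarrow> complex) \<Rightarrow> bool" where
  "sobolev_continuous_on s I f \<longleftrightarrow> (\<forall>t\<in>I. f t \<in> sobolev s) \<and>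
     (\<forall>t\<in>I. ((\<lambda>r. sobolev_norm s (\<lambda>x. f r x - f t x)) \<longlongrightarrow> 0) (at t within I))"

text \<open>
  The Bochner integral over a bounded interval \<open>I\<close> of a function with values in \<open>H\<^sup>s\<close>, along the
  lines of \<open>has_bochner_integral\<close>, which does not apply because \<open>sobolev s\<close> is a set with a seminorm
  and not a type. Strong measurability of \<open>F\<close> follows from the approximation in mean.
\<close>

definition sobolev_simple ::
    "nat \<Rightarrow> real set \<Rightarrow> (real \<Rightarrow> real ^ 'd \<Rightarrow> complex) \<Rightarrow> bool" where
  "sobolev_simple s I G \<longleftrightarrow> finite (G ` I) \<and> G ` I \<subseteq> sobolev s \<and>
     (\<forall>h\<in>G ` I. {\<tau>\<in>I. G \<tau> = h} \<in> sets lborel)"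

definition sobolev_simple_integral ::
    "real set \<Rightarrow> (real \<Rightarrow> real ^ 'd \<Rightarrow> complex) \<Rightarrow> real ^ 'd \<Rightarrow> complex" where
  "sobolev_simple_integral I G x = (\<Sum>h\<in>G ` I. measure lborel {\<tau>\<in>I. G \<tau> = h} *\<^sub>R h x)"

definition has_sobolev_integral ::
    "nat \<Rightarrow> (real \<Rightarrow> real ^ 'd \<Rightarrow> complex) \<Rightarrow> (real ^ 'd \<Rightarrow> complex) \<Rightarrow> real set \<Rightarrow> bool" where
  "has_sobolev_integral s F g I \<longleftrightarrow>
     (\<forall>\<tau>\<in>I. F \<tau> \<in> sobolev s) \<and> g \<in> sobolev s \<and>
     (\<exists>G. (\<forall>n. sobolev_simple s I (G n) \<and>
               set_integrable lborel I (\<lambda>\<tau>. sobolev_norm s (\<lambda>x. F \<tau> x - G n \<tau> x))) \<and>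
          (\<lambda>n. LINT \<tau>:I|lborel. sobolev_norm s (\<lambda>x. F \<tau> x - G n \<tau> x)) \<longlonglongrightarrow> 0 \<and>
          (\<lambda>n. sobolev_norm s (\<lambda>x. sobolev_simple_integral I (G n) x - g x)) \<longlonglongrightarrow> 0)"


section \<open>The controlled equation\<close>

text \<open>
  The semigroup generated by \<open>V + (1 + i\<nu>)\<Delta>\<close> on the torus. This operator acts on Fourier
  coefficients as multiplication by \<open>V - (1 + i\<nu>)|k|\<^sup>2\<close>. For \<open>f\<close> in \<open>H\<^sup>s\<close> with \<open>s > d/2\<close> and
  \<open>t \<ge> 0\<close> the series converges absolutely at every point.
\<close>

definition semigroup_symbol :: "real \<Rightarrow> real \<Rightarrow> int ^ 'd \<Rightarrow> complex" where
  "semigroup_symbol V \<nu> k = of_real V - (1 + \<i> * of_real \<nu>) * of_real ((norm (real_vec k))\<^sup>2)"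

definition cgl_semigroup ::
    "real \<Rightarrow> real \<Rightarrow> real \<Rightarrow> (real ^ 'd \<Rightarrow> complex) \<Rightarrow> real ^ 'd \<Rightarrow> complex" where
  "cgl_semigroup V \<nu> t f x =
     (\<Sum>\<^sub>\<infinity>k. exp (of_real t * semigroup_symbol V \<nu> k) * fourier_coeff f k
              * exp (\<i> * of_real (real_vec k \<bullet> x)))"

definition cgl_rhs ::
    "nat \<Rightarrow> real \<Rightarrow> real \<Rightarrow> (real ^ 'd \<Rightarrow> real ^ 'q) \<Rightarrow> real ^ 'q
       \<Rightarrow> (real ^ 'd \<Rightarrow> complex) \<Rightarrow> real ^ 'd \<Rightarrow> complex" where
  "cgl_rhs \<sigma> \<mu> R Q v \<phi> x =
     - (1 + \<i> * of_real \<mu>) * of_real (cmod (\<phi> x) ^ (2 * \<sigma>)) * \<phi> x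
     + (1 + \<i> * of_real R) * of_real (v \<bullet> Q x) * \<phi> x"

definition L2_control :: "real \<Rightarrow> (real \<Rightarrow> real ^ 'q) \<Rightarrow> bool" where
  "L2_control T u \<longleftrightarrow> set_borel_measurable lborel {0..T} u \<and>
     set_integrable lborel {0..T} (\<lambda>t. (norm (u t))\<^sup>2)"

text \<open>The initial condition is the instance \<open>t = 0\<close> of the Duhamel formula.\<close>

definition mild_solution ::
    "nat \<Rightarrow> nat \<Rightarrow> real \<Rightarrow> real \<Rightarrow> real \<Rightarrow> real \<Rightarrow> (real ^ 'd \<Rightarrow> real ^ 'q) \<Rightarrow> real
       \<Rightarrow> (real \<Rightarrow> real ^ 'q) \<Rightarrow> (real ^ 'd \<Rightarrow> complex) \<Rightarrow> (real \<Rightarrow> real ^ 'd \<Rightarrow> complex) \<Rightarrow> bool" where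
  "mild_solution s \<sigma> V \<nu> \<mu> R Q T u \<psi>\<^sub>0 \<psi> \<longleftrightarrow>
     sobolev_continuous_on s {0..T} \<psi> \<and>
     (\<forall>t\<in>{0..T}. has_sobolev_integral s
        (\<lambda>\<tau>. cgl_semigroup V \<nu> (t - \<tau>) (cgl_rhs \<sigma> \<mu> R Q (u \<tau>) (\<psi> \<tau>)))
        (\<lambda>x. \<psi> t x - cgl_semigroup V \<nu> t \<psi>\<^sub>0 x) {0..t})"

end

(*
  The constant function lies in the span of the controls, so a constant control adds the damping term
  - c (1 + i R) psi to the equation, with c as large as we like. On Fourier coefficients, weighted by
  (1 + |k|^2)^(s/2), H^s becomes a space of square summable families. It is an algebra under
  convolution because s > d/2, and hence the nonlinearity is Lipschitz on balls. With c = V + 2 a the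
  substitution phi(t) = exp (a t) psi(t) turns the damped equation into one whose linear part decays
  like exp (- a t) and whose nonlinearity keeps its Lipschitz constant L on the ball of radius
  M = 2 |psi_0|. For a >= 2 L the Duhamel map is a contraction of the ball of radius M in the space of
  bounded continuous functions, so |psi(T)| <= exp (- a T) M, which is small for large a.
*)

theory Submission
  imports Defs
begin

section \<open>The Hilbert space of square summable families\<close>

text \<open>Elements of \<open>sobolev s\<close> are representatives under a seminorm, so vector
  integrals and Banach's theorem do not apply to them. The analysis therefore takes place in the
  Banach type \<open>ell2\<close>; \<open>synth\<close> carries the result back, and Riemann sums
  identify the integral there with \<open>has_sobolev_integral\<close>.

  The choice of constants is not circular: M depends on the initial datum and L on M, neither on a,
  so a can be chosen last. L survives the substitution because the nonlinearity n becomes exp (a t)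
  n (exp (- a t) b): the inner factor keeps b in the ball, and in differences the two factors
  cancel. Of the damping V + 2 a, the part V offsets the growth of the semigroup, one a pays for the
  substitution and the other remains as decay. Duhamel integrals then gain the factor 1 / a instead
  of the length of the interval, so a single contraction covers all of \<open>{0..T}\<close>.

  The fixed point solves the Duhamel formula of the damped, rescaled generator, whereas
  \<open>mild_solution\<close> demands that of V + (1 + i \<nu>) \<Delta> with the control inside
  the integral. These generators are unbounded but diagonal, so the formulas are compared one
  Fourier coefficient at a time.\<close>

definition square_summable :: "('i \<Rightarrow> complex) \<Rightarrow> bool" where
  "square_summable f \<longleftrightarrow> (\<lambda>i. (cmod (f i))\<^sup>2) summable_on UNIV"

lemma square_summableI:
  assumes "\<And>F. finite F \<Longrightarrow> (\<Sum>i\<in>F. (cmod (f i))\<^sup>2) \<le> B"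
  shows "square_summable f" "(\<Sum>\<^sub>\<infinity>i. (cmod (f i))\<^sup>2) \<le> B"
proof -
  show *: "square_summable f"
    unfolding square_summable_def
    by (rule nonneg_bdd_above_summable_on) (auto intro!: bdd_aboveI2 assms)
  then show "(\<Sum>\<^sub>\<infinity>i. (cmod (f i))\<^sup>2) \<le> B"
    unfolding square_summable_def using assms by (intro infsum_le_finite_sums) auto
qed

text \<open>Minkowski on a finite set, with the bounds as parameters so that the norms over the
  whole index set can be inserted later.\<close>

lemma sum_square_cmod_add_le:
  assumes "(\<Sum>i\<in>F. (cmod (f i))\<^sup>2) \<le> A\<^sup>2" "(\<Sum>i\<in>F. (cmod (g i))\<^sup>2) \<le> B\<^sup>2" "0 \<le> A" "0 \<le> B"
  shows "(\<Sum>i\<in>F. (cmod (f i + g i))\<^sup>2) \<le> (A + B)\<^sup>2"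
proof -
  have "L2_set (\<lambda>i. cmod (f i + g i)) F \<le> L2_set (\<lambda>i. cmod (f i) + cmod (g i)) F"
    by (intro L2_set_mono norm_triangle_ineq) auto
  also have "\<dots> \<le> L2_set (\<lambda>i. cmod (f i)) F + L2_set (\<lambda>i. cmod (g i)) F"
    by (rule L2_set_triangle_ineq)
  also have "\<dots> \<le> A + B"
    unfolding L2_set_def using assms by (intro add_mono real_le_lsqrt) (auto intro: sum_nonneg)
  finally have "(L2_set (\<lambda>i. cmod (f i + g i)) F)\<^sup>2 \<le> (A + B)\<^sup>2"
    by (intro power_mono) auto
  then show ?thesis
    by (simp add: L2_set_def sum_nonneg)
qed

lemma sum_square_cmod_le_infsum:
  assumes "square_summable f" "finite F"
  shows "(\<Sum>i\<in>F. (cmod (f i))\<^sup>2) \<le> (sqrt (\<Sum>\<^sub>\<infinity>i. (cmod (f i))\<^sup>2))\<^sup>2"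
  using assms unfolding square_summable_def
  by (subst real_sqrt_pow2) (auto intro!: finite_sum_le_infsum infsum_nonneg)

lemma square_summable_add:
  assumes "square_summable f" "square_summable g"
  shows "square_summable (\<lambda>i. f i + g i)"
    "sqrt (\<Sum>\<^sub>\<infinity>i. (cmod (f i + g i))\<^sup>2)
      \<le> sqrt (\<Sum>\<^sub>\<infinity>i. (cmod (f i))\<^sup>2) + sqrt (\<Sum>\<^sub>\<infinity>i. (cmod (g i))\<^sup>2)"
proof -
  note le = sum_square_cmod_add_le[OF sum_square_cmod_le_infsum[OF assms(1)] sum_square_cmod_le_infsum[OF assms(2)]]
  show "square_summable (\<lambda>i. f i + g i)"
    by (rule square_summableI, rule le) (auto intro: infsum_nonneg)
  have "(\<Sum>\<^sub>\<infinity>i. (cmod (f i + g i))\<^sup>2) \<le> (sqrt (\<Sum>\<^sub>\<infinity>i. (cmod (f i))\<^sup>2) + sqrt (\<Sum>\<^sub>\<infinity>i. (cmod (g i))\<^sup>2))\<^sup>2"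
    by (rule square_summableI, rule le) (auto intro: infsum_nonneg)
  then show "sqrt (\<Sum>\<^sub>\<infinity>i. (cmod (f i + g i))\<^sup>2)
      \<le> sqrt (\<Sum>\<^sub>\<infinity>i. (cmod (f i))\<^sup>2) + sqrt (\<Sum>\<^sub>\<infinity>i. (cmod (g i))\<^sup>2)"
    by (intro real_le_lsqrt) (auto intro!: infsum_nonneg add_nonneg_nonneg)
qed

lemma square_summable_mult:
  assumes "square_summable f" "\<And>i. cmod (m i) \<le> B"
  shows "square_summable (\<lambda>i. m i * f i)"
    "sqrt (\<Sum>\<^sub>\<infinity>i. (cmod (m i * f i))\<^sup>2) \<le> B * sqrt (\<Sum>\<^sub>\<infinity>i. (cmod (f i))\<^sup>2)"
proof -
  have B: "0 \<le> B"
    using order_trans[OF norm_ge_zero assms(2)] .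
  have le: "(\<Sum>i\<in>F. (cmod (m i * f i))\<^sup>2) \<le> (B * sqrt (\<Sum>\<^sub>\<infinity>i. (cmod (f i))\<^sup>2))\<^sup>2" if "finite F" for F
  proof -
    have "(\<Sum>i\<in>F. (cmod (m i * f i))\<^sup>2) \<le> (\<Sum>i\<in>F. B\<^sup>2 * (cmod (f i))\<^sup>2)"
      by (intro sum_mono) (auto simp: norm_mult power_mult_distrib intro!: mult_right_mono power_mono assms)
    also have "\<dots> \<le> B\<^sup>2 * (sqrt (\<Sum>\<^sub>\<infinity>i. (cmod (f i))\<^sup>2))\<^sup>2"
      unfolding sum_distrib_left[symmetric]
      by (intro mult_left_mono sum_square_cmod_le_infsum assms that) auto
    finally show ?thesis by (simp add: power_mult_distrib)
  qed
  show "square_summable (\<lambda>i. m i * f i)"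
    by (rule square_summableI, rule le)
  show "sqrt (\<Sum>\<^sub>\<infinity>i. (cmod (m i * f i))\<^sup>2) \<le> B * sqrt (\<Sum>\<^sub>\<infinity>i. (cmod (f i))\<^sup>2)"
    by (rule real_le_lsqrt, intro mult_nonneg_nonneg B)
      (auto intro!: infsum_nonneg square_summableI(2) le)
qed

typedef 'i ell2 = "{f :: 'i \<Rightarrow> complex. square_summable f}"
  morphisms coord Abs_ell2
  by (rule exI[of _ "\<lambda>_. 0"]) (simp add: square_summable_def)

setup_lifting type_definition_ell2

lemma ell2_eqI: "(\<And>i. coord a i = coord b i) \<Longrightarrow> a = b"
  by (simp add: coord_inject[symmetric] fun_eq_iff)

lemma square_summable_coord: "square_summable (coord a)"
  using coord[of a] by simp

instantiation ell2 :: (type) real_vector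
begin

lift_definition zero_ell2 :: "'a ell2" is "\<lambda>_. 0"
  by (simp add: square_summable_def)

lift_definition plus_ell2 :: "'a ell2 \<Rightarrow> 'a ell2 \<Rightarrow> 'a ell2" is "\<lambda>f g i. f i + g i"
  by (rule square_summable_add)

lift_definition uminus_ell2 :: "'a ell2 \<Rightarrow> 'a ell2" is "\<lambda>f i. - f i"
  by (simp add: square_summable_def)

lift_definition minus_ell2 :: "'a ell2 \<Rightarrow> 'a ell2 \<Rightarrow> 'a ell2" is "\<lambda>f g i. f i - g i"
proof -
  fix f g :: "'a \<Rightarrow> complex"
  assume "square_summable f" "square_summable g"
  then have "square_summable (\<lambda>i. f i + - g i)"
    by (intro square_summable_add) (auto simp: square_summable_def)
  then show "square_summable (\<lambda>i. f i - g i)"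
    by simp
qed

lift_definition scaleR_ell2 :: "real \<Rightarrow> 'a ell2 \<Rightarrow> 'a ell2" is "\<lambda>r f i. r *\<^sub>R f i"
  unfolding scaleR_conv_of_real by (rule square_summable_mult[where B = "\<bar>r\<bar>" for r]) auto

instance
proof
  fix x y z :: "'a ell2" and r s :: real
  show "x + y + z = x + (y + z)" "x + y = y + x" "0 + x = x" "- x + x = 0" "x - y = x + - y"
    by (transfer, simp add: algebra_simps)+
  show "r *\<^sub>R (x + y) = r *\<^sub>R x + r *\<^sub>R y" "(r + s) *\<^sub>R x = r *\<^sub>R x + s *\<^sub>R x"
    "r *\<^sub>R s *\<^sub>R x = (r * s) *\<^sub>R x" "1 *\<^sub>R x = x"
    by (transfer, simp add: algebra_simps)+
qed

end

instantiation ell2 :: (type) real_normed_vector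
begin

lift_definition norm_ell2 :: "'a ell2 \<Rightarrow> real" is "\<lambda>f. sqrt (\<Sum>\<^sub>\<infinity>i. (cmod (f i))\<^sup>2)" .

definition sgn_ell2 :: "'a ell2 \<Rightarrow> 'a ell2" where
  "sgn_ell2 x = x /\<^sub>R norm x"

definition dist_ell2 :: "'a ell2 \<Rightarrow> 'a ell2 \<Rightarrow> real" where
  "dist_ell2 x y = norm (x - y)"

definition uniformity_ell2 :: "('a ell2 \<times> 'a ell2) filter" where
  "uniformity_ell2 = (INF e\<in>{0 <..}. principal {(x, y). dist x y < e})"

definition open_ell2 :: "'a ell2 set \<Rightarrow> bool" where
  "open_ell2 S = (\<forall>x\<in>S. \<forall>\<^sub>F (x', y) in uniformity. x' = x \<longrightarrow> y \<in> S)"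

instance
proof
  fix x y :: "'a ell2" and r :: real
  show "(norm x = 0) = (x = 0)"
  proof transfer
    fix f :: "'a \<Rightarrow> complex"
    assume f: "square_summable f"
    have "f i = 0" if "(\<Sum>\<^sub>\<infinity>i. (cmod (f i))\<^sup>2) = 0" for i
      using nonneg_infsum_le_0D[of "\<lambda>i. (cmod (f i))\<^sup>2" UNIV i] f that
      by (auto simp: square_summable_def)
    then have "(\<Sum>\<^sub>\<infinity>i. (cmod (f i))\<^sup>2) = 0 \<longleftrightarrow> f = (\<lambda>_. 0)"
      by (metis (mono_tags, lifting) ext infsum_0 norm_zero power_zero_numeral)
    then show "(sqrt (\<Sum>\<^sub>\<infinity>i. (cmod (f i))\<^sup>2) = 0) = (f = (\<lambda>_. 0))"
      by simp
  qed
  show "norm (x + y) \<le> norm x + norm y"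
    by transfer (rule square_summable_add)
  show "norm (r *\<^sub>R x) = \<bar>r\<bar> * norm x"
    by transfer (simp add: power_mult_distrib infsum_cmult_right' real_sqrt_mult)
qed (simp_all add: sgn_ell2_def dist_ell2_def uniformity_ell2_def open_ell2_def)

end

lemma coord_simps [simp]:
  "coord 0 i = 0" "coord (a + b) i = coord a i + coord b i" "coord (a - b) i = coord a i - coord b i"
  "coord (- a) i = - coord a i" "coord (r *\<^sub>R a) i = r *\<^sub>R coord a i"
  by (transfer, simp)+

lemma coord_sum: "coord (sum f F) i = (\<Sum>j\<in>F. coord (f j) i)"
  by (induction F rule: infinite_finite_induct) auto

lemma norm_ell2_sq: "(norm a)\<^sup>2 = (\<Sum>\<^sub>\<infinity>i. (cmod (coord a i))\<^sup>2)"
  by transfer (simp add: infsum_nonneg)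

lemma summable_on_coord_sq: "(\<lambda>i. (cmod (coord a i))\<^sup>2) summable_on A"
  using square_summable_coord[of a] summable_on_subset_banach
  unfolding square_summable_def by blast

lemma sum_coord_sq_le: "finite F \<Longrightarrow> (\<Sum>i\<in>F. (cmod (coord a i))\<^sup>2) \<le> (norm a)\<^sup>2"
  unfolding norm_ell2_sq by (intro finite_sum_le_infsum summable_on_coord_sq) auto

lemma norm_coord_le: "cmod (coord a i) \<le> norm a"
  using sum_coord_sq_le[of "{i}" a] by (simp add: abs_le_square_iff[symmetric])

lemma norm_ell2_leI:
  assumes "\<And>F. finite F \<Longrightarrow> (\<Sum>i\<in>F. (cmod (coord a i))\<^sup>2) \<le> B\<^sup>2" "0 \<le> B"
  shows "norm a \<le> B"
proof -
  have "(norm a)\<^sup>2 \<le> B\<^sup>2"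
    unfolding norm_ell2_sq by (rule square_summableI) (rule assms)
  then show ?thesis
    using assms by (simp add: abs_le_square_iff[symmetric])
qed

lemma coord_Abs_ell2: "square_summable f \<Longrightarrow> coord (Abs_ell2 f) = f"
  by (rule Abs_ell2_inverse) simp

lemma bounded_linear_coord: "bounded_linear (\<lambda>a. coord a i)"
  by (rule bounded_linear_intro[of _ 1]) (auto simp: norm_coord_le)

text \<open>Each coordinate is Cauchy, which gives the candidate \<open>l\<close>. A bound on
  \<open>X m - X n\<close> restricts to finite index sets, where it passes to the limit in
  \<open>n\<close>; being uniform in the set, it yields both that \<open>l\<close> is square
  summable and that \<open>X\<close> converges to it in norm.\<close>

instance ell2 :: (type) banach
proof
  fix X :: "nat \<Rightarrow> 'a ell2"
  assume "Cauchy X"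
  have "Cauchy (\<lambda>n. coord (X n) i)" for i
    by (rule bounded_linear.Cauchy[OF bounded_linear_coord \<open>Cauchy X\<close>])
  then obtain l where l: "\<And>i. (\<lambda>n. coord (X n) i) \<longlonglongrightarrow> l i"
    unfolding Cauchy_convergent_iff convergent_def by metis
  have le: "(\<Sum>i\<in>F. (cmod (coord (X m) i - l i))\<^sup>2) \<le> e\<^sup>2"
    if "\<And>n. n \<ge> N \<Longrightarrow> norm (X m - X n) \<le> e" "finite F" for m e N F
  proof (rule tendsto_upperbound)
    show "((\<lambda>n. \<Sum>i\<in>F. (cmod (coord (X m) i - coord (X n) i))\<^sup>2) \<longlongrightarrow>
        (\<Sum>i\<in>F. (cmod (coord (X m) i - l i))\<^sup>2)) sequentially"
      by (intro tendsto_intros l)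
    have "(\<Sum>i\<in>F. (cmod (coord (X m) i - coord (X n) i))\<^sup>2) \<le> e\<^sup>2" if "n \<ge> N" for n
    proof -
      have "(\<Sum>i\<in>F. (cmod (coord (X m) i - coord (X n) i))\<^sup>2) \<le> (norm (X m - X n))\<^sup>2"
        using sum_coord_sq_le[OF \<open>finite F\<close>, of "X m - X n"] by simp
      also have "\<dots> \<le> e\<^sup>2"
        by (intro power_mono that \<open>\<And>n. n \<ge> N \<Longrightarrow> norm (X m - X n) \<le> e\<close>) auto
      finally show ?thesis .
    qed
    then show "\<forall>\<^sub>F n in sequentially. (\<Sum>i\<in>F. (cmod (coord (X m) i - coord (X n) i))\<^sup>2) \<le> e\<^sup>2"
      by (auto simp: eventually_sequentially)
  qed auto
  have Cauchy: "\<exists>N. \<forall>m\<ge>N. \<forall>n\<ge>N. norm (X m - X n) \<le> e" if "e > 0" for e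
    using \<open>Cauchy X\<close> that unfolding Cauchy_def dist_norm by (meson less_imp_le)
  have "square_summable l"
  proof -
    obtain N where N: "\<forall>m\<ge>N. \<forall>n\<ge>N. norm (X m - X n) \<le> 1"
      using Cauchy[of 1] by auto
    have "square_summable (\<lambda>i. coord (X N) i - l i)"
      by (rule square_summableI[of _ "1\<^sup>2"], rule le[of N]) (use N in auto)
    then have "square_summable (\<lambda>i. coord (X N) i + - (coord (X N) i - l i))"
      by (intro square_summable_add square_summable_coord)
        (simp only: square_summable_def norm_minus_cancel)
    then show ?thesis by simp
  qed
  have "X \<longlonglongrightarrow> Abs_ell2 l"
  proof (rule metric_LIMSEQ_I)
    fix e :: real
    assume "e > 0"
    then obtain N where N: "\<forall>m\<ge>N. \<forall>n\<ge>N. norm (X m - X n) \<le> e / 2"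
      using Cauchy[of "e / 2"] by auto
    have "norm (X m - Abs_ell2 l) \<le> e / 2" if "m \<ge> N" for m
      by (rule norm_ell2_leI, simp add: coord_Abs_ell2 \<open>square_summable l\<close>, rule le[of N])
        (use N that \<open>e > 0\<close> in auto)
    then have "\<forall>m\<ge>N. dist (X m) (Abs_ell2 l) < e"
      using \<open>e > 0\<close> by (force simp: dist_norm)
    then show "\<exists>N. \<forall>n\<ge>N. dist (X n) (Abs_ell2 l) < e" by blast
  qed
  then show "convergent X"
    by (auto simp: convergent_def)
qed

section \<open>Diagonal operators and their strong continuity\<close>

definition ell2_mult :: "('i \<Rightarrow> complex) \<Rightarrow> 'i ell2 \<Rightarrow> 'i ell2" where
  "ell2_mult m a = Abs_ell2 (\<lambda>i. m i * coord a i)"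

text \<open>Without a bound on \<open>m\<close> the product may leave the space and
  \<open>Abs_ell2\<close> returns an unspecified element, hence the explicit \<open>B\<close> in all
  facts on \<open>ell2_mult\<close>.\<close>

lemma coord_ell2_mult:
  assumes "\<And>i. cmod (m i) \<le> B"
  shows "coord (ell2_mult m a) i = m i * coord a i"
  unfolding ell2_mult_def
  using square_summable_mult(1)[of "coord a" m, OF square_summable_coord assms] by (simp add: coord_Abs_ell2)

lemma norm_ell2_mult_le:
  assumes "\<And>i. cmod (m i) \<le> B"
  shows "norm (ell2_mult m a) \<le> B * norm a"
  using square_summable_mult[of "coord a" m, OF square_summable_coord assms]
  by (simp add: norm_ell2.rep_eq ell2_mult_def coord_Abs_ell2)

lemma bounded_linear_ell2_mult:
  assumes "\<And>i. cmod (m i) \<le> B"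
  shows "bounded_linear (ell2_mult m)"
  by (rule bounded_linear_intro[of _ B])
    (auto intro!: ell2_eqI norm_ell2_mult_le assms simp: coord_ell2_mult[of m, OF assms] algebra_simps mult.commute[of _ B])

definition ell2_unit :: "'i \<Rightarrow> complex \<Rightarrow> 'i ell2" where
  "ell2_unit i z = Abs_ell2 (\<lambda>j. if j = i then z else 0)"

lemma coord_ell2_unit: "coord (ell2_unit i z) j = (if j = i then z else 0)"
proof -
  have "square_summable (\<lambda>j. if j = i then z else 0)"
    unfolding square_summable_def by (rule finite_nonzero_values_imp_summable_on) simp
  then show ?thesis
    by (simp add: ell2_unit_def coord_Abs_ell2)
qed

lemma norm_ell2_unit: "norm (ell2_unit i z) = cmod z"
proof -
  have "(norm (ell2_unit i z))\<^sup>2 = (\<Sum>\<^sub>\<infinity>j\<in>{i}. (cmod z)\<^sup>2)"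
    unfolding norm_ell2_sq by (rule infsum_cong_neutral) (auto simp: coord_ell2_unit)
  then show ?thesis by simp
qed

lemma bounded_linear_ell2_unit: "bounded_linear (ell2_unit i)"
  by (rule bounded_linear_intro[of _ 1])
    (auto intro!: ell2_eqI simp: coord_ell2_unit norm_ell2_unit)

text \<open>By orthogonality the squared norm of the remainder is the full sum minus the partial
  sum. Finite sums of units are the elements on which continuity of multipliers is
  elementary.\<close>

lemma sum_ell2_unit_tendsto:
  "((\<lambda>F. \<Sum>i\<in>F. ell2_unit i (coord a i)) \<longlongrightarrow> a) (finite_subsets_at_top UNIV)"
proof -
  define r where "r F = a - (\<Sum>i\<in>F. ell2_unit i (coord a i))" for F
  have eq: "norm (r F) = sqrt ((norm a)\<^sup>2 - (\<Sum>i\<in>F. (cmod (coord a i))\<^sup>2))" if "finite F" for F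
  proof -
    have coord: "coord (r F) j = (if j \<in> F then 0 else coord a j)" for j
      using that by (auto simp: r_def coord_sum coord_ell2_unit)
    have "(norm (r F))\<^sup>2 = (\<Sum>\<^sub>\<infinity>j\<in>UNIV - F. (cmod (coord a j))\<^sup>2)"
      unfolding norm_ell2_sq by (rule infsum_cong_neutral) (auto simp: coord)
    also have "\<dots> = (norm a)\<^sup>2 - (\<Sum>i\<in>F. (cmod (coord a i))\<^sup>2)"
      unfolding norm_ell2_sq using that by (subst infsum_Diff) (auto intro: summable_on_coord_sq)
    finally show ?thesis
      by (metis norm_ge_zero real_sqrt_unique)
  qed
  have "((\<lambda>F. \<Sum>i\<in>F. (cmod (coord a i))\<^sup>2) \<longlongrightarrow> (norm a)\<^sup>2) (finite_subsets_at_top UNIV)"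
    unfolding norm_ell2_sq by (rule infsum_tendsto[OF summable_on_coord_sq])
  then have "((\<lambda>F. sqrt ((norm a)\<^sup>2 - (\<Sum>i\<in>F. (cmod (coord a i))\<^sup>2))) \<longlongrightarrow> sqrt ((norm a)\<^sup>2 - (norm a)\<^sup>2))
      (finite_subsets_at_top UNIV)"
    by (intro tendsto_intros)
  then have "((\<lambda>F. norm (r F)) \<longlongrightarrow> 0) (finite_subsets_at_top UNIV)"
    by (subst tendsto_cong[OF eventually_finite_subsets_at_top_weakI]) (auto intro: eq)
  then have "((\<lambda>F. norm ((\<Sum>i\<in>F. ell2_unit i (coord a i)) - a)) \<longlongrightarrow> 0) (finite_subsets_at_top UNIV)"
    by (simp only: r_def norm_minus_commute)
  then show ?thesis
    by (rule LIM_zero_cancel[OF tendsto_norm_zero_cancel])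
qed

text \<open>Only strong continuity can be expected: \<open>m\<close> is continuous in
  \<open>x\<close> for each \<open>i\<close>, not uniformly in \<open>i\<close>. On finitely
  supported elements the claim concerns finitely many coordinates, and the bound \<open>B\<close>
  makes the approximation by such elements uniform in \<open>x\<close>.\<close>

lemma continuous_on_ell2_mult_const:
  assumes cont: "\<And>i. continuous_on U (\<lambda>x. m x i)"
    and bound: "\<And>x i. x \<in> U \<Longrightarrow> cmod (m x i) \<le> B"
  shows "continuous_on U (\<lambda>x. ell2_mult (m x) a)"
proof (rule uniform_limit_theorem)
  let ?s = "\<lambda>F. \<Sum>i\<in>F. ell2_unit i (coord a i)"
  have eq: "ell2_mult (m x) (?s F) = (\<Sum>i\<in>F. ell2_unit i (m x i * coord a i))" if "x \<in> U" for x F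
    by (rule ell2_eqI)
      (auto simp: coord_ell2_mult[of "m x", OF bound[OF that]] coord_sum coord_ell2_unit sum_distrib_left intro!: sum.cong)
  have "continuous_on U (\<lambda>x. \<Sum>i\<in>F. ell2_unit i (m x i * coord a i))" for F
    by (intro continuous_intros bounded_linear.continuous_on[OF bounded_linear_ell2_unit] cont)
  then show "\<forall>\<^sub>F F in finite_subsets_at_top UNIV. continuous_on U (\<lambda>x. ell2_mult (m x) (?s F))"
    using eq by (intro always_eventually allI) (simp cong: continuous_on_cong)
  have "((\<lambda>F. B * norm (?s F - a)) \<longlongrightarrow> B * 0) (finite_subsets_at_top UNIV)"
    by (intro tendsto_intros tendsto_norm_zero LIM_zero sum_ell2_unit_tendsto)
  then have lim: "((\<lambda>F. B * norm (?s F - a)) \<longlongrightarrow> 0) (finite_subsets_at_top UNIV)" by simp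
  show "uniform_limit U (\<lambda>F x. ell2_mult (m x) (?s F)) (\<lambda>x. ell2_mult (m x) a) (finite_subsets_at_top UNIV)"
  proof (rule uniform_limitI)
    fix e :: real
    assume "e > 0"
    have "dist (ell2_mult (m x) (?s F)) (ell2_mult (m x) a) \<le> B * norm (?s F - a)" if "x \<in> U" for x F
      using norm_ell2_mult_le[of "m x", OF bound[OF that]]
      by (simp add: dist_norm linear_diff[OF bounded_linear.linear, OF bounded_linear_ell2_mult[of "m x", OF bound[OF that]], symmetric])
    then show "\<forall>\<^sub>F F in finite_subsets_at_top UNIV. \<forall>x\<in>U. dist (ell2_mult (m x) (?s F)) (ell2_mult (m x) a) < e"
      using order_tendstoD(2)[OF lim \<open>e > 0\<close>] by (elim eventually_mono) (meson le_less_trans)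
  qed
qed simp

text \<open>Splitting \<open>ell2_mult (m y) (f y)\<close> into the operator at \<open>y\<close>
  applied to \<open>f y - f x\<close> and to \<open>f x\<close> separates the two variables: the
  first part is controlled by the uniform bound, the second by strong continuity.\<close>

lemma continuous_on_ell2_mult:
  assumes cont: "\<And>i. continuous_on U (\<lambda>x. m x i)"
    and bound: "\<And>x i. x \<in> U \<Longrightarrow> cmod (m x i) \<le> B"
    and f: "continuous_on U f"
  shows "continuous_on U (\<lambda>x. ell2_mult (m x) (f x))"
  unfolding continuous_on_def
proof
  fix x
  assume x: "x \<in> U"
  have U: "\<forall>\<^sub>F y in at x within U. y \<in> U"
    by (simp add: eventually_at_filter)
  have "((\<lambda>y. B * norm (f y - f x)) \<longlongrightarrow> B * 0) (at x within U)"
    using f x unfolding continuous_on_def by (intro tendsto_intros tendsto_norm_zero LIM_zero) auto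
  then have lim: "((\<lambda>y. B * norm (f y - f x)) \<longlongrightarrow> 0) (at x within U)"
    by simp
  have "norm (ell2_mult (m y) (f y - f x)) \<le> B * norm (f y - f x)" if "y \<in> U" for y
    by (rule norm_ell2_mult_le) (rule bound[OF that])
  then have "\<forall>\<^sub>F y in at x within U. norm (ell2_mult (m y) (f y - f x)) \<le> B * norm (f y - f x)"
    by (rule eventually_mono[OF U])
  then have zero: "((\<lambda>y. ell2_mult (m y) (f y - f x)) \<longlongrightarrow> 0) (at x within U)"
    by (rule Lim_null_comparison[OF _ lim])
  have "continuous_on U (\<lambda>y. ell2_mult (m y) (f x))"
    by (rule continuous_on_ell2_mult_const[where m = m, OF cont bound])
  then have "((\<lambda>y. ell2_mult (m y) (f x)) \<longlongrightarrow> ell2_mult (m x) (f x)) (at x within U)"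
    using x by (rule continuous_on_def[THEN iffD1, rule_format])
  from tendsto_add[OF zero this]
  have "((\<lambda>y. ell2_mult (m y) (f y - f x) + ell2_mult (m y) (f x)) \<longlongrightarrow> 0 + ell2_mult (m x) (f x)) (at x within U)"
    .
  then have sum: "((\<lambda>y. ell2_mult (m y) (f y - f x) + ell2_mult (m y) (f x)) \<longlongrightarrow> ell2_mult (m x) (f x)) (at x within U)"
    by simp
  have "ell2_mult (m y) (f y - f x) + ell2_mult (m y) (f x) = ell2_mult (m y) (f y)" if "y \<in> U" for y
    by (simp add: linear_diff[OF bounded_linear.linear, OF bounded_linear_ell2_mult[of "m y", OF bound[OF that]]])
  then show "((\<lambda>y. ell2_mult (m y) (f y)) \<longlongrightarrow> ell2_mult (m x) (f x)) (at x within U)"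
    by (rule Lim_transform_eventually[OF sum eventually_mono[OF U]])
qed

section \<open>A fixed point of the Duhamel map\<close>

text \<open>These are the features of an exponentially decaying semigroup that enter the contraction
  argument. Continuity is joint in time and state, so that integrands
  \<open>S (t - \<tau>) (g \<tau>)\<close> are continuous.\<close>

locale decaying_family =
  fixes S :: "real \<Rightarrow> 'a \<Rightarrow> 'a::banach" and a :: real
  assumes decay_pos: "a > 0"
    and linear: "t \<ge> 0 \<Longrightarrow> bounded_linear (S t)"
    and at_zero: "S 0 x = x"
    and decay: "t \<ge> 0 \<Longrightarrow> norm (S t x) \<le> exp (- a * t) * norm x"
    and continuous: "continuous_on ({0..} \<times> UNIV) (\<lambda>(t, x). S t x)"
begin

lemma continuous_on_family:
  assumes "continuous_on U f" "continuous_on U g" "\<And>x. x \<in> U \<Longrightarrow> 0 \<le> f x"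
  shows "continuous_on U (\<lambda>x. S (f x) (g x))"
  using continuous_on_compose2[OF continuous continuous_on_Pair[OF assms(1,2)]] assms(3) by auto

text \<open>Both the domain and the integrand depend on \<open>t\<close>. Extending the integrand by
  \<open>max 0 (t - \<tau>)\<close> fixes the domain as \<open>{0..T}\<close>; beyond
  \<open>t\<close> the operator is \<open>S 0\<close>, the identity, so the surplus is the integral
  of \<open>g\<close> over \<open>{t..T}\<close> and can be subtracted.\<close>

lemma continuous_on_duhamel:
  assumes g: "continuous_on {0..T} g"
  shows "continuous_on {0..T} (\<lambda>t. integral {0..t} (\<lambda>\<tau>. S (t - \<tau>) (g \<tau>)))"
proof -
  let ?h = "\<lambda>t \<tau>. S (max 0 (t - \<tau>)) (g \<tau>)"
  have "integral {0..t} (\<lambda>\<tau>. S (t - \<tau>) (g \<tau>)) = integral {0..T} (?h t) - integral {0..T} g + integral {0..t} g"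
    if t: "t \<in> {0..T}" for t
  proof -
    have h: "?h t integrable_on {0..T}"
      by (intro integrable_continuous_interval continuous_on_family g continuous_intros) auto
    have g': "g integrable_on {0..T}"
      by (rule integrable_continuous_interval[OF g])
    have "integral {0..T} (?h t) = integral {0..t} (?h t) + integral {t..T} (?h t)"
      "integral {0..T} g = integral {0..t} g + integral {t..T} g"
      using t h g' by (simp_all add: Henstock_Kurzweil_Integration.integral_combine)
    moreover have "integral {t..T} (?h t) = integral {t..T} g"
      by (rule integral_cong) (auto simp: at_zero)
    moreover have "integral {0..t} (?h t) = integral {0..t} (\<lambda>\<tau>. S (t - \<tau>) (g \<tau>))"
      by (rule integral_cong) auto
    ultimately show ?thesis by simp
  qed
  moreover have "continuous_on {0..T} (\<lambda>t. integral {0..T} (?h t))"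
  proof -
    have "continuous_on ({0..T} \<times> {0..T}) (\<lambda>x. S (max 0 (fst x - snd x)) (g (snd x)))"
      by (intro continuous_on_family continuous_intros continuous_on_compose2[OF g]) auto
    then show ?thesis
      using integral_continuous_on_param[of "{0..T}" 0 T ?h] by (simp add: case_prod_unfold)
  qed
  moreover have "continuous_on {0..T} (\<lambda>t. integral {0..t} g)"
    by (intro indefinite_integral_continuous_1 integrable_continuous_interval g)
  ultimately show ?thesis
    by (subst continuous_on_cong[OF refl, where g="\<lambda>t. integral {0..T} (?h t) - integral {0..T} g + integral {0..t} g"])
      (blast, intro continuous_intros)
qed

text \<open>The kernel \<open>exp (- a * (t - \<tau>))\<close> has integral at most
  \<open>1 / a\<close> over \<open>{0..t}\<close>, whatever \<open>t\<close> is.\<close>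

lemma norm_duhamel_le:
  assumes g: "continuous_on {0..t} g" and K: "\<And>\<tau>. \<tau> \<in> {0..t} \<Longrightarrow> norm (g \<tau>) \<le> K" and t: "0 \<le> t"
  shows "norm (integral {0..t} (\<lambda>\<tau>. S (t - \<tau>) (g \<tau>))) \<le> K / a"
proof -
  have "0 \<le> K"
    using order_trans[OF norm_ge_zero K[of 0]] t by simp
  have "((\<lambda>\<tau>. exp (- a * (t - \<tau>)) * K) has_integral
      exp (- a * (t - t)) * K / a - exp (- a * (t - 0)) * K / a) {0..t}"
    using t decay_pos
    by (intro fundamental_theorem_of_calculus)
      (auto simp flip: has_real_derivative_iff_has_vector_derivative intro!: derivative_eq_intros)
  then have int: "((\<lambda>\<tau>. exp (- a * (t - \<tau>)) * K) has_integral K / a - exp (- a * t) * K / a) {0..t}"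
    by simp
  have "norm (integral {0..t} (\<lambda>\<tau>. S (t - \<tau>) (g \<tau>))) \<le> integral {0..t} (\<lambda>\<tau>. exp (- a * (t - \<tau>)) * K)"
  proof (rule integral_norm_bound_integral)
    show "(\<lambda>\<tau>. S (t - \<tau>) (g \<tau>)) integrable_on {0..t}"
      by (intro integrable_continuous_interval continuous_on_family g continuous_intros) auto
    show "norm (S (t - \<tau>) (g \<tau>)) \<le> exp (- a * (t - \<tau>)) * K" if "\<tau> \<in> {0..t}" for \<tau>
      using that by (intro order_trans[OF decay] mult_left_mono K) auto
  qed (use int in auto)
  also have "\<dots> \<le> K / a"
    unfolding integral_unique[OF int] using \<open>0 \<le> K\<close> decay_pos by simp
  finally show ?thesis .
qed

text \<open>The inequality \<open>2 * L \<le> a\<close> makes \<open>L / a\<close> at most one half.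
  With \<open>N t 0 = 0\<close> the Duhamel integral thus has norm at most \<open>M / 2\<close>, and
  the initial term takes the other half of the radius; the same ratio is the contraction
  factor.\<close>

theorem duhamel_fixed_point:
  fixes N :: "real \<Rightarrow> 'a \<Rightarrow> 'a"
  assumes N: "continuous_on ({0..T} \<times> cball 0 M) (\<lambda>(t, x). N t x)"
    and lip: "\<And>t. t \<in> {0..T} \<Longrightarrow> L-lipschitz_on (cball 0 M) (N t)"
    and zero: "\<And>t. t \<in> {0..T} \<Longrightarrow> N t 0 = 0"
    and "2 * L \<le> a" "2 * norm x0 \<le> M" "0 \<le> T"
  obtains \<phi> where "continuous_on {0..T} \<phi>" "\<And>t. t \<in> {0..T} \<Longrightarrow> norm (\<phi> t) \<le> M"
    "\<And>t. t \<in> {0..T} \<Longrightarrow> \<phi> t = S t x0 + integral {0..t} (\<lambda>\<tau>. S (t - \<tau>) (N \<tau> (\<phi> \<tau>)))"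
proof -
  have M: "0 \<le> M"
    using assms(5) norm_ge_zero[of x0] by linarith
  have L: "0 \<le> L"
    using lip[of 0] \<open>0 \<le> T\<close> by (auto dest: lipschitz_on_nonneg)
  define G where "G \<phi> t = S t x0 + integral {0..t} (\<lambda>\<tau>. S (t - \<tau>) (N \<tau> (\<phi> \<tau>)))" for \<phi> t
  \<comment> \<open>\<open>bcontfun\<close> consists of functions on the whole line, so time is
    clamped to \<open>{0..T}\<close> and the images under the fixed point map are constant on either
    side of it.\<close>
  define cl where "cl t = max 0 (min T t)" for t
  have cl: "cl t \<in> {0..T}" for t
    using \<open>0 \<le> T\<close> by (auto simp: cl_def)
  define B where "B = (cball 0 M :: (real \<Rightarrow>\<^sub>C 'a) set)"
  have ball: "apply_bcontfun \<phi> t \<in> cball 0 M" if "\<phi> \<in> B" for \<phi> t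
    using that dist_bounded[of 0 t \<phi>] by (simp add: B_def)
  have Nc: "continuous_on {0..T} (\<lambda>t. N t (apply_bcontfun \<phi> t))" if "\<phi> \<in> B" for \<phi>
  proof -
    have "continuous_on {0..T} (apply_bcontfun \<phi>)"
      using apply_bcontfun[of \<phi>] by (auto simp: bcontfun_def intro: continuous_on_subset)
    then show ?thesis
      using continuous_on_compose2[OF N continuous_on_Pair[OF continuous_on_id]] ball[OF that]
      by (auto simp: image_subset_iff)
  qed
  have Gc: "continuous_on {0..T} (G (apply_bcontfun \<phi>))" if "\<phi> \<in> B" for \<phi>
    unfolding G_def
    by (intro continuous_intros continuous_on_family continuous_on_duhamel Nc that) auto
  have lip': "norm (N t x - N t y) \<le> L * norm (x - y)"
    if "t \<in> {0..T}" "x \<in> cball 0 M" "y \<in> cball 0 M" for t x y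
    using lipschitz_on_normD[OF lip that(2,3)] that(1) by blast
  have Gb: "norm (G (apply_bcontfun \<phi>) t) \<le> M" if "\<phi> \<in> B" "t \<in> {0..T}" for \<phi> t
  proof -
    have "norm (N \<tau> (apply_bcontfun \<phi> \<tau>)) \<le> L * M" if "\<tau> \<in> {0..t}" for \<tau>
    proof -
      have "norm (N \<tau> (apply_bcontfun \<phi> \<tau>)) \<le> L * norm (apply_bcontfun \<phi> \<tau>)"
        using lip'[of \<tau> "apply_bcontfun \<phi> \<tau>" 0] ball[OF \<open>\<phi> \<in> B\<close>] M zero[of \<tau>] that \<open>t \<in> {0..T}\<close>
        by auto
      also have "\<dots> \<le> L * M"
        using ball[OF \<open>\<phi> \<in> B\<close>] L by (intro mult_left_mono) auto
      finally show ?thesis .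
    qed
    then have "norm (integral {0..t} (\<lambda>\<tau>. S (t - \<tau>) (N \<tau> (apply_bcontfun \<phi> \<tau>)))) \<le> L * M / a"
      using that by (intro norm_duhamel_le continuous_on_subset[OF Nc]) auto
    also have "\<dots> \<le> M / 2"
      using mult_right_mono[OF \<open>2 * L \<le> a\<close> M] decay_pos by (simp add: field_simps)
    finally have "norm (integral {0..t} (\<lambda>\<tau>. S (t - \<tau>) (N \<tau> (apply_bcontfun \<phi> \<tau>)))) \<le> M / 2" .
    moreover have "norm (S t x0) \<le> M / 2"
    proof -
      have "norm (S t x0) \<le> 1 * norm x0"
        using that decay_pos by (intro order_trans[OF decay] mult_right_mono) auto
      then show ?thesis
        using \<open>2 * norm x0 \<le> M\<close> by simp
    qed
    ultimately show ?thesis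
      unfolding G_def by (intro order_trans[OF norm_triangle_ineq]) simp
  qed
  have Gd: "norm (G (apply_bcontfun \<phi>) t - G (apply_bcontfun \<eta>) t) \<le> 1 / 2 * dist \<phi> \<eta>"
    if "\<phi> \<in> B" "\<eta> \<in> B" "t \<in> {0..T}" for \<phi> \<eta> t
  proof -
    let ?d = "\<lambda>\<tau>. N \<tau> (apply_bcontfun \<phi> \<tau>) - N \<tau> (apply_bcontfun \<eta> \<tau>)"
    have int: "(\<lambda>\<tau>. S (t - \<tau>) (N \<tau> (apply_bcontfun \<rho> \<tau>))) integrable_on {0..t}" if "\<rho> \<in> B" for \<rho>
      using \<open>t \<in> {0..T}\<close>
      by (intro integrable_continuous_interval continuous_on_family continuous_intros
          continuous_on_subset[OF Nc[OF that]]) auto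
    have "G (apply_bcontfun \<phi>) t - G (apply_bcontfun \<eta>) t = integral {0..t} (\<lambda>\<tau>. S (t - \<tau>) (?d \<tau>))"
      unfolding G_def
      by (simp add: integral_diff[OF int int, symmetric] that)
        (rule integral_cong, simp add: linear_diff[OF bounded_linear.linear, OF linear])
    also have "norm \<dots> \<le> (L * dist \<phi> \<eta>) / a"
    proof (rule norm_duhamel_le)
      fix \<tau>
      assume \<tau>: "\<tau> \<in> {0..t}"
      have "norm (?d \<tau>) \<le> L * dist (apply_bcontfun \<phi> \<tau>) (apply_bcontfun \<eta> \<tau>)"
        unfolding dist_norm using \<tau> that by (intro lip' ball) auto
      also have "\<dots> \<le> L * dist \<phi> \<eta>"
        by (intro mult_left_mono dist_bounded L)
      finally show "norm (?d \<tau>) \<le> L * dist \<phi> \<eta>" .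
    next
      show "continuous_on {0..t} ?d"
        using that(3) by (intro continuous_intros continuous_on_subset[OF Nc[OF that(1)]] continuous_on_subset[OF Nc[OF that(2)]]) auto
    qed (use that in auto)
    also have "\<dots> \<le> 1 / 2 * dist \<phi> \<eta>"
      using mult_right_mono[OF \<open>2 * L \<le> a\<close>, of "dist \<phi> \<eta>"] decay_pos by (simp add: field_simps)
    finally show ?thesis .
  qed
  define \<Phi> where "\<Phi> \<phi> = Bcontfun (\<lambda>t. G (apply_bcontfun \<phi>) (cl t))" for \<phi>
  have \<Phi>: "apply_bcontfun (\<Phi> \<phi>) t = G (apply_bcontfun \<phi>) (cl t)" if "\<phi> \<in> B" for \<phi> t
  proof -
    have "continuous_on UNIV cl"
      unfolding cl_def by (intro continuous_intros)
    then have "continuous_on UNIV (\<lambda>t. G (apply_bcontfun \<phi>) (cl t))"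
      using cl by (intro continuous_on_compose2[OF Gc[OF that]]) auto
    then have "(\<lambda>t. G (apply_bcontfun \<phi>) (cl t)) \<in> bcontfun"
      using Gb[OF that] cl by (auto intro!: bcontfun_normI)
    then show ?thesis
      by (simp add: \<Phi>_def Bcontfun_inverse)
  qed
  have "\<exists>!\<phi>\<in>B. \<Phi> \<phi> = \<phi>"
  proof (rule Banach_fix[where c = "1 / 2"])
    show "complete B"
      by (simp add: B_def complete_eq_closed)
    show "B \<noteq> {}"
      using M by (simp add: B_def)
    show "\<Phi> ` B \<subseteq> B"
    proof (intro image_subsetI)
      fix \<phi>
      assume "\<phi> \<in> B"
      then have "dist 0 (\<Phi> \<phi>) \<le> M"
        using Gb[OF _ cl] by (intro dist_bound) (simp add: \<Phi>)
      then show "\<Phi> \<phi> \<in> B"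
        by (simp add: B_def)
    qed
    show "dist (\<Phi> \<phi>) (\<Phi> \<eta>) \<le> 1 / 2 * dist \<phi> \<eta>" if "\<phi> \<in> B" "\<eta> \<in> B" for \<phi> \<eta>
      using Gd[OF that cl] that by (intro dist_bound) (simp add: \<Phi> dist_norm)
  qed auto
  then obtain \<phi> where \<phi>: "\<phi> \<in> B" "\<Phi> \<phi> = \<phi>" by auto
  have fixp: "apply_bcontfun \<phi> t = G (apply_bcontfun \<phi>) t" if "t \<in> {0..T}" for t
    using \<Phi>[OF \<phi>(1), of t] that by (simp add: \<phi>(2) cl_def)
  show thesis
  proof (rule that[of "apply_bcontfun \<phi>"])
    show "continuous_on {0..T} (apply_bcontfun \<phi>)"
      using Gc[OF \<phi>(1)] fixp by (simp cong: continuous_on_cong)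
    show "norm (apply_bcontfun \<phi> t) \<le> M" for t
      using ball[OF \<phi>(1)] by simp
  qed (use fixp in \<open>simp add: G_def\<close>)
qed

end

section \<open>Weights and convolution\<close>

lemma real_vec_simps [simp]:
  "real_vec 0 = 0" "real_vec (j + k) = real_vec j + real_vec k"
  "real_vec (- k) = - real_vec k" "real_vec (j - k) = real_vec j - real_vec k"
  by (simp_all add: real_vec_def vec_eq_iff)

definition weight :: "nat \<Rightarrow> int ^ 'd \<Rightarrow> real" where
  "weight s k = (1 + (norm (real_vec k))\<^sup>2) ^ s"

lemma weight_ge_1: "1 \<le> weight s k"
  by (simp add: weight_def one_le_power)

lemma weight_pos [simp]: "0 < weight s k" "weight s k \<noteq> 0" "0 \<le> weight s k"
  using weight_ge_1[of s k] by linarith+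

lemma weight_uminus [simp]: "weight s (- k) = weight s k"
  by (simp add: weight_def)

text \<open>A crude Peetre inequality: since |j + k|^2 \<le> 2 |j|^2 + 2 |k|^2, the base at
  \<open>j + k\<close> is at most 4 times the larger of the two bases, and the power of a maximum is
  at most the sum of the powers.\<close>

lemma weight_add_le: "weight s (j + k) \<le> 4 ^ s * (weight s j + weight s k)"
proof -
  let ?b = "\<lambda>k. 1 + (norm (real_vec k))\<^sup>2"
  have lin: "1 + x \<le> 4 * max (1 + y) (1 + z)" if "x \<le> 2 * y + 2 * z" "0 \<le> y" "0 \<le> z" for x y z :: real
    using that by (auto simp: max_def)
  have "(norm (real_vec (j + k)))\<^sup>2 \<le> (norm (real_vec j) + norm (real_vec k))\<^sup>2"
    by (intro power_mono) (auto intro: norm_triangle_ineq)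
  also have "\<dots> \<le> 2 * (norm (real_vec j))\<^sup>2 + 2 * (norm (real_vec k))\<^sup>2"
    using sum_squares_bound[of "norm (real_vec j)" "norm (real_vec k)"] by (simp add: power2_sum)
  finally have "?b (j + k) \<le> 4 * max (?b j) (?b k)"
    by (rule lin) auto
  then have "weight s (j + k) \<le> 4 ^ s * max (?b j) (?b k) ^ s"
    unfolding weight_def by (subst power_mult_distrib[symmetric]) (intro power_mono, auto)
  also have "max (?b j) (?b k) ^ s \<le> weight s j + weight s k"
    using weight_pos[of s j] weight_pos[of s k] by (auto simp: max_def weight_def)
  finally show ?thesis by simp
qed

lemma summable_on_one_plus_square_powr:
  fixes r :: real
  assumes "r > 1 / 2"
  shows "(\<lambda>n::int. (1 + (real_of_int n)\<^sup>2) powr - r) summable_on UNIV"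
proof -
  let ?g = "\<lambda>n::int. (1 + (real_of_int n)\<^sup>2) powr - r"
  have "summable (\<lambda>n. real n powr - (2 * r))"
    using assms by (subst summable_real_powr_iff) auto
  \<comment> \<open>The comparison starts at 1: at 0 the majorant is a power of 0, which is 0,
    whereas the term is 1.\<close>
  then have "summable (\<lambda>n. ?g (int n))"
  proof (rule summable_comparison_test'[where N = 1])
    fix n :: nat
    assume "1 \<le> n"
    then have "real n powr - (2 * r) = (real n powr 2) powr - r"
      by (simp only: powr_powr) simp
    also have "real n powr 2 = (real n)\<^sup>2"
      using \<open>1 \<le> n\<close> by simp
    finally have "real n powr - (2 * r) = ((real n)\<^sup>2) powr - r" .
    moreover have "(1 + (real n)\<^sup>2) powr - r \<le> ((real n)\<^sup>2) powr - r"
      using \<open>1 \<le> n\<close> assms by (intro powr_mono2') auto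
    ultimately show "norm (?g (int n)) \<le> real n powr - (2 * r)" by simp
  qed
  then have nat: "(\<lambda>n. ?g (int n)) summable_on UNIV"
    by (intro norm_summable_imp_summable_on) simp
  have "?g summable_on range int" "?g summable_on range (\<lambda>n. - int n)"
    using nat by (subst summable_on_reindex; simp add: o_def inj_on_def)+
  then have "?g summable_on (range int \<union> range (\<lambda>n. - int n))"
    by (rule summable_on_union)
  also have "range int \<union> range (\<lambda>n. - int n) = UNIV"
    by (auto intro: int_cases2)
  finally show ?thesis .
qed

text \<open>Writing the inverse weight as a product of \<open>CARD('d)\<close> equal factors, and
  dropping in each of them all but one squared component, bounds it by a product of one-dimensional
  terms with exponent s / d. This exponent exceeds 1/2 exactly when d < 2 s.\<close>

lemma summable_on_inverse_weight:
  assumes "real CARD('d) < 2 * real s"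
  shows "(\<lambda>k::int ^ 'd. 1 / weight s k) summable_on UNIV"
proof -
  let ?d = "real CARD('d)"
  let ?r = "real s / ?d"
  let ?g = "\<lambda>n::int. (1 + (real_of_int n)\<^sup>2) powr - ?r"
  have d: "?d > 0" by simp
  have g: "?g summable_on UNIV"
    using assms d by (intro summable_on_one_plus_square_powr) (simp add: field_simps)
  have le: "1 / weight s k \<le> (\<Prod>i\<in>UNIV. ?g (k $ i))" for k :: "int ^ 'd"
  proof -
    have pos: "0 < 1 + (norm (real_vec k))\<^sup>2"
      by (simp add: add_pos_nonneg)
    have "1 / weight s k = (1 + (norm (real_vec k))\<^sup>2) powr - real s"
      by (simp add: weight_def powr_minus powr_realpow add_pos_nonneg divide_inverse)
    also have "\<dots> = (\<Prod>i\<in>(UNIV::'d set). (1 + (norm (real_vec k))\<^sup>2) powr - ?r)"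
      using pos by (simp add: powr_powr flip: powr_realpow)
    also have "\<dots> \<le> (\<Prod>i\<in>UNIV. ?g (k $ i))"
    proof (intro prod_mono conjI powr_mono2')
      fix i :: 'd
      have "\<bar>real_of_int (k $ i)\<bar> \<le> norm (real_vec k)"
        using component_le_norm_cart[of "real_vec k" i] by (simp add: real_vec_def)
      then show "1 + (real_of_int (k $ i))\<^sup>2 \<le> 1 + (norm (real_vec k))\<^sup>2"
        by (simp add: abs_le_square_iff[symmetric])
    qed (auto intro: add_pos_nonneg)
    finally show ?thesis .
  qed
  have bound: "(\<Sum>k\<in>F. 1 / weight s k) \<le> infsum ?g UNIV ^ CARD('d)" if "finite F" for F :: "(int ^ 'd) set"
  proof -
    \<comment> \<open>\<open>A\<close> collects all components of points of \<open>F\<close>, so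
      \<open>F\<close> lies in the box with sides \<open>A\<close>, over which a sum of products is
      a product of sums.\<close>
    define A where "A = (\<Union>i. (\<lambda>k. k $ i) ` F)"
    have A: "finite A" using that by (simp add: A_def)
    have "(\<Sum>k\<in>F. 1 / weight s k) \<le> (\<Sum>k\<in>F. \<Prod>i\<in>UNIV. ?g (k $ i))"
      by (intro sum_mono le)
    also have "\<dots> = (\<Sum>h\<in>($) ` F. \<Prod>i\<in>UNIV. ?g (h i))"
      by (subst sum.reindex) (auto simp: inj_on_def vec_eq_iff)
    also have "\<dots> \<le> (\<Sum>h\<in>Pi\<^sub>E (UNIV :: 'd set) (\<lambda>_. A). \<Prod>i\<in>UNIV. ?g (h i))"
    proof (rule sum_mono2)
      show "finite (Pi\<^sub>E (UNIV :: 'd set) (\<lambda>_. A))"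
        using A by (intro finite_PiE) auto
      show "($) ` F \<subseteq> Pi\<^sub>E UNIV (\<lambda>_. A)"
        by (auto simp: A_def)
    qed (auto intro!: prod_nonneg)
    also have "\<dots> = (\<Prod>i\<in>(UNIV::'d set). \<Sum>n\<in>A. ?g n)"
      using A by (subst prod_sum_PiE) auto
    also have "\<dots> \<le> infsum ?g UNIV ^ CARD('d)"
      using finite_sum_le_infsum[OF g A] by (simp add: power_mono sum_nonneg)
    finally show ?thesis .
  qed
  show ?thesis
    by (rule nonneg_bdd_above_summable_on) (auto intro!: bdd_aboveI2 bound)
qed

text \<open>
  A function in \<open>H\<^sup>s\<close> is represented by its Fourier coefficients multiplied by the square roots
  of the weights, so that its \<open>H\<^sup>s\<close> norm is the norm in \<open>ell2\<close>.
\<close>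

definition sob_coeff :: "nat \<Rightarrow> (int ^ 'd) ell2 \<Rightarrow> int ^ 'd \<Rightarrow> complex" where
  "sob_coeff s a k = coord a k / of_real (sqrt (weight s k))"

lemma sob_coeff_simps:
  "sob_coeff s (a + b) k = sob_coeff s a k + sob_coeff s b k"
  "sob_coeff s (a - b) k = sob_coeff s a k - sob_coeff s b k"
  "sob_coeff s (r *\<^sub>R a) k = r *\<^sub>R sob_coeff s a k"
  by (simp_all add: sob_coeff_def add_divide_distrib diff_divide_distrib scaleR_conv_of_real)

lemma norm_sob_coeff: "cmod (sob_coeff s a k) = cmod (coord a k) / sqrt (weight s k)"
  by (simp add: sob_coeff_def norm_divide)

lemma norm_sob_coeff_le: "cmod (sob_coeff s a k) \<le> norm a"
proof -
  have "cmod (coord a k) / sqrt (weight s k) \<le> cmod (coord a k) / 1"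
    using weight_ge_1[of s k] by (intro divide_left_mono) auto
  then show ?thesis
    using norm_coord_le[of a k] by (simp add: norm_sob_coeff)
qed

lemma sum_summable_has_sum:
  fixes f :: "'a \<Rightarrow> 'b \<Rightarrow> 'c :: real_normed_vector"
  assumes "\<And>k. k \<in> F \<Longrightarrow> f k summable_on A"
  shows "((\<lambda>j. \<Sum>k\<in>F. f k j) has_sum (\<Sum>k\<in>F. infsum (f k) A)) A"
  using assms by (induction F rule: infinite_finite_induct) (auto intro!: has_sum_add has_sum_infsum)

definition sob_conv :: "nat \<Rightarrow> (int ^ 'd) ell2 \<Rightarrow> (int ^ 'd) ell2 \<Rightarrow> int ^ 'd \<Rightarrow> complex" where
  "sob_conv s a b k = (\<Sum>\<^sub>\<infinity>j. sob_coeff s a j * sob_coeff s b (k - j))"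

text \<open>For functions this is the pointwise product: \<open>sob_conv\<close> gives its Fourier
  coefficients and the factor turns them into weighted coordinates. That these are square summable
  follows from \<open>sum_sob_conv_le\<close>.\<close>

definition sob_mult :: "nat \<Rightarrow> (int ^ 'd) ell2 \<Rightarrow> (int ^ 'd) ell2 \<Rightarrow> (int ^ 'd) ell2" where
  "sob_mult s a b = Abs_ell2 (\<lambda>k. of_real (sqrt (weight s k)) * sob_conv s a b k)"

section \<open>The algebra property above the critical index\<close>

locale sobolev_algebra =
  fixes s :: nat and dim :: "'d::finite itself"
  assumes crit: "real CARD('d) < 2 * real s"
begin

definition inv_weight_sum :: real where
  "inv_weight_sum = (\<Sum>\<^sub>\<infinity>k::int ^ 'd. 1 / weight s k)"

lemma sum_inverse_weight_le:
  "finite F \<Longrightarrow> (\<Sum>k\<in>F. 1 / weight s (k::int ^ 'd)) \<le> inv_weight_sum"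
  unfolding inv_weight_sum_def
  by (intro finite_sum_le_infsum summable_on_inverse_weight crit) auto

lemma inv_weight_sum_nonneg: "0 \<le> inv_weight_sum"
  using sum_inverse_weight_le[of "{}"] by simp

text \<open>Cauchy-Schwarz against the inverse weights. This is the Sobolev embedding in the form of
  absolutely convergent Fourier series.\<close>

lemma abs_summable_sob_coeff: "(\<lambda>k. cmod (sob_coeff s a k)) summable_on (UNIV :: (int ^ 'd) set)"
proof (rule nonneg_bdd_above_summable_on)
  have "(\<Sum>k\<in>F. cmod (sob_coeff s a k)) \<le> norm a * sqrt inv_weight_sum" if "finite F" for F
  proof -
    have "(\<Sum>k\<in>F. cmod (sob_coeff s a k)) = (\<Sum>k\<in>F. \<bar>cmod (coord a k)\<bar> * \<bar>1 / sqrt (weight s k)\<bar>)"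
      by (simp add: norm_sob_coeff)
    also have "\<dots> \<le> L2_set (\<lambda>k. cmod (coord a k)) F * L2_set (\<lambda>k. 1 / sqrt (weight s k)) F"
      by (rule L2_set_mult_ineq)
    also have "\<dots> \<le> norm a * sqrt inv_weight_sum"
      unfolding L2_set_def
      using sum_coord_sq_le[OF that, of a] sum_inverse_weight_le[OF that]
      by (intro mult_mono real_le_lsqrt real_sqrt_le_mono)
        (auto simp: power_divide intro!: sum_nonneg)
    finally show ?thesis .
  qed
  then show "bdd_above (sum (\<lambda>k. cmod (sob_coeff s a k)) ` {F. F \<subseteq> UNIV \<and> finite F})"
    by (auto intro!: bdd_aboveI2)
qed auto

lemma abs_summable_sob_conv:
  "(\<lambda>j. cmod (sob_coeff s a j * sob_coeff s b (k - j))) summable_on (UNIV :: (int ^ 'd) set)"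
proof (rule Infinite_Sum.abs_summable_on_comparison_test)
  show "(\<lambda>j. norm (norm b *\<^sub>R sob_coeff s a j)) summable_on UNIV"
    using summable_on_cmult_right[OF abs_summable_sob_coeff, of "norm b"] by simp
  show "norm (sob_coeff s a j * sob_coeff s b (k - j)) \<le> norm (norm b *\<^sub>R sob_coeff s a j)" for j
    using mult_left_mono[OF norm_sob_coeff_le[of s b "k - j"], of "cmod (sob_coeff s a j)"]
    by (simp add: norm_mult mult.commute)
qed

text \<open>The factor \<open>4 ^ s\<close> comes from \<open>weight_add_le\<close>, the 2 from the
  two sums of inverse weights, at \<open>j\<close> and at \<open>k - j\<close>.\<close>

definition conv_const :: real where
  "conv_const = 2 * 4 ^ s * inv_weight_sum"

text \<open>Dividing \<open>weight_add_le\<close> for \<open>j + (k - j)\<close> by all three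
  weights splits each term into inverse weights at \<open>j\<close> and at \<open>k - j\<close>,
  whose sums are bounded uniformly in \<open>k\<close>. This kernel bound is the reason why
  convolution preserves the decay of order \<open>s\<close>.\<close>

lemma sum_weight_quotient_le:
  fixes k :: "int ^ 'd"
  assumes "finite F"
  shows "(\<Sum>j\<in>F. 1 / (weight s j * weight s (k - j))) \<le> conv_const / weight s k"
proof -
  have "(\<Sum>j\<in>F. 1 / (weight s j * weight s (k - j)))
      \<le> (\<Sum>j\<in>F. 4 ^ s / weight s k * (1 / weight s j + 1 / weight s (k - j)))"
  proof (rule sum_mono)
    fix j
    have "weight s k \<le> 4 ^ s * (weight s j + weight s (k - j))"
      using weight_add_le[of s j "k - j"] by simp
    then have "weight s k / (weight s k * (weight s j * weight s (k - j)))
        \<le> 4 ^ s * (weight s j + weight s (k - j)) / (weight s k * (weight s j * weight s (k - j)))"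
      by (intro divide_right_mono) auto
    also have "\<dots> = 4 ^ s / weight s k * (1 / weight s j + 1 / weight s (k - j))"
      by (simp add: field_simps)
    finally show "1 / (weight s j * weight s (k - j)) \<le> 4 ^ s / weight s k * (1 / weight s j + 1 / weight s (k - j))"
      by simp
  qed
  also have "\<dots> = 4 ^ s / weight s k * ((\<Sum>j\<in>F. 1 / weight s j) + (\<Sum>j\<in>F. 1 / weight s (k - j)))"
    by (simp only: sum_distrib_left[symmetric] sum.distrib)
  also have "(\<Sum>j\<in>F. 1 / weight s (k - j)) = (\<Sum>j\<in>(\<lambda>j. k - j) ` F. 1 / weight s j)"
    by (subst sum.reindex) (auto simp: inj_on_def)
  also have "4 ^ s / weight s k * ((\<Sum>j\<in>F. 1 / weight s j) + (\<Sum>j\<in>(\<lambda>j. k - j) ` F. 1 / weight s j))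
      \<le> 4 ^ s / weight s k * (inv_weight_sum + inv_weight_sum)"
    using assms by (intro mult_left_mono add_mono sum_inverse_weight_le) auto
  also have "\<dots> = conv_const / weight s k"
    by (simp add: conv_const_def)
  finally show ?thesis .
qed

lemma summable_conv_sq:
  "(\<lambda>j. (cmod (coord a j))\<^sup>2 * (cmod (coord b (k - j)))\<^sup>2) summable_on (UNIV :: (int ^ 'd) set)"
proof (rule summable_on_comparison_test)
  show "(\<lambda>j. (cmod (coord a j))\<^sup>2 * (norm b)\<^sup>2) summable_on UNIV"
    by (intro summable_on_cmult_left summable_on_coord_sq)
qed (auto intro!: mult_left_mono power_mono norm_coord_le)

text \<open>Cauchy-Schwarz in \<open>j\<close> separates the kernel
  \<open>1 / (weight s j * weight s (k - j))\<close>, whose sum cancels the outer weight up to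
  \<open>conv_const\<close>, from the squared coordinates. What remains is the convolution of two
  summable families, estimated by summing over \<open>k\<close> first.\<close>

lemma sum_sob_conv_le:
  assumes F: "finite F"
  shows "(\<Sum>k\<in>F. (cmod (of_real (sqrt (weight s k)) * sob_conv s a b k))\<^sup>2)
    \<le> (sqrt conv_const * norm a * norm (b :: (int ^ 'd) ell2))\<^sup>2"
proof -
  have C: "0 \<le> conv_const"
    using inv_weight_sum_nonneg by (simp add: conv_const_def)
  let ?D = "\<lambda>k j. (cmod (coord a j))\<^sup>2 * (cmod (coord b (k - j)))\<^sup>2"
  have D: "0 \<le> infsum (?D k) UNIV" for k
    by (intro infsum_nonneg) auto
  have "cmod (sob_conv s a b k) \<le> sqrt (conv_const / weight s k) * sqrt (infsum (?D k) UNIV)" for k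
  proof -
    have "cmod (sob_conv s a b k) \<le> (\<Sum>\<^sub>\<infinity>j. cmod (sob_coeff s a j * sob_coeff s b (k - j)))"
      unfolding sob_conv_def by (rule norm_infsum_bound[OF abs_summable_sob_conv])
    also have "\<dots> \<le> sqrt (conv_const / weight s k) * sqrt (infsum (?D k) UNIV)"
    proof (rule infsum_le_finite_sums[OF abs_summable_sob_conv])
      fix J :: "(int ^ 'd) set"
      assume J: "finite J"
      have "(\<Sum>j\<in>J. cmod (sob_coeff s a j * sob_coeff s b (k - j)))
          = (\<Sum>j\<in>J. \<bar>1 / sqrt (weight s j * weight s (k - j))\<bar> * \<bar>cmod (coord a j) * cmod (coord b (k - j))\<bar>)"
        by (intro sum.cong) (simp_all add: norm_mult norm_sob_coeff real_sqrt_mult abs_mult)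
      also have "\<dots> \<le> L2_set (\<lambda>j. 1 / sqrt (weight s j * weight s (k - j))) J
          * L2_set (\<lambda>j. cmod (coord a j) * cmod (coord b (k - j))) J"
        by (rule L2_set_mult_ineq)
      also have "\<dots> \<le> sqrt (conv_const / weight s k) * sqrt (infsum (?D k) UNIV)"
        unfolding L2_set_def
        using sum_weight_quotient_le[OF J, of k] finite_sum_le_infsum[OF summable_conv_sq J, of a b k]
        by (intro mult_mono real_sqrt_le_mono)
          (auto simp: power_divide power_mult_distrib C intro!: sum_nonneg D divide_nonneg_pos)
      finally show "(\<Sum>j\<in>J. cmod (sob_coeff s a j * sob_coeff s b (k - j)))
          \<le> sqrt (conv_const / weight s k) * sqrt (infsum (?D k) UNIV)" .
    qed
    finally show ?thesis .
  qed
  then have sq: "(cmod (sob_conv s a b k))\<^sup>2 \<le> (sqrt (conv_const / weight s k) * sqrt (infsum (?D k) UNIV))\<^sup>2" for k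
    by (intro power_mono) auto
  have le: "(cmod (sob_conv s a b k))\<^sup>2 \<le> conv_const / weight s k * infsum (?D k) UNIV" for k
    using sq[of k] divide_nonneg_pos[OF C weight_pos(1), of s k] D[of k]
    by (simp only: power_mult_distrib real_sqrt_pow2)
  have "(\<Sum>k\<in>F. (cmod (of_real (sqrt (weight s k)) * sob_conv s a b k))\<^sup>2)
      = (\<Sum>k\<in>F. weight s k * (cmod (sob_conv s a b k))\<^sup>2)"
    by (simp add: norm_mult power_mult_distrib)
  also have "\<dots> \<le> (\<Sum>k\<in>F. weight s k * (conv_const / weight s k * infsum (?D k) UNIV))"
    by (intro sum_mono mult_left_mono le) auto
  also have "\<dots> = conv_const * (\<Sum>k\<in>F. infsum (?D k) UNIV)"
    by (simp add: sum_distrib_left)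
  also have "(\<Sum>k\<in>F. infsum (?D k) UNIV) = (\<Sum>\<^sub>\<infinity>j. \<Sum>k\<in>F. ?D k j)"
    by (rule infsumI[symmetric, OF sum_summable_has_sum]) (rule summable_conv_sq)
  also have "\<dots> \<le> (\<Sum>\<^sub>\<infinity>j. (cmod (coord a j))\<^sup>2 * (norm b)\<^sup>2)"
  proof (rule infsum_mono)
    show "(\<lambda>j. \<Sum>k\<in>F. ?D k j) summable_on UNIV"
      using sum_summable_has_sum[OF summable_conv_sq] by (rule has_sum_imp_summable)
    show "(\<lambda>j. (cmod (coord a j))\<^sup>2 * (norm b)\<^sup>2) summable_on UNIV"
      by (intro summable_on_cmult_left summable_on_coord_sq)
    fix j
    have "(\<Sum>k\<in>F. (cmod (coord b (k - j)))\<^sup>2) = (\<Sum>k\<in>(\<lambda>k. k - j) ` F. (cmod (coord b k))\<^sup>2)"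
      by (subst sum.reindex) (auto simp: inj_on_def)
    also have "\<dots> \<le> (norm b)\<^sup>2"
      using F by (intro sum_coord_sq_le) auto
    finally show "(\<Sum>k\<in>F. ?D k j) \<le> (cmod (coord a j))\<^sup>2 * (norm b)\<^sup>2"
      by (simp add: mult_left_mono flip: sum_distrib_left)
  qed
  also have "\<dots> = (norm a)\<^sup>2 * (norm b)\<^sup>2"
    unfolding norm_ell2_sq[of a] by (rule infsum_cmult_left')
  finally show ?thesis
    using C by (simp add: power_mult_distrib mult_left_mono mult.assoc)
qed

lemma coord_sob_mult: "coord (sob_mult s a b) k = of_real (sqrt (weight s k)) * sob_conv s a b (k :: int ^ 'd)"
  unfolding sob_mult_def by (subst coord_Abs_ell2) (rule square_summableI[OF sum_sob_conv_le], simp_all)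

lemma sob_coeff_sob_mult: "sob_coeff s (sob_mult s a b) k = sob_conv s a b (k :: int ^ 'd)"
  by (simp add: sob_coeff_def coord_sob_mult)

lemma bounded_bilinear_sob_mult: "bounded_bilinear (sob_mult s :: (int ^ 'd) ell2 \<Rightarrow> _)"
proof
  note summable = abs_summable_summable[OF abs_summable_sob_conv]
  fix a a' b b' :: "(int ^ 'd) ell2" and r :: real
  show "sob_mult s (a + a') b = sob_mult s a b + sob_mult s a' b"
    by (rule ell2_eqI)
      (simp add: coord_sob_mult sob_conv_def sob_coeff_simps algebra_simps infsum_add summable)
  show "sob_mult s a (b + b') = sob_mult s a b + sob_mult s a b'"
    by (rule ell2_eqI)
      (simp add: coord_sob_mult sob_conv_def sob_coeff_simps algebra_simps infsum_add summable)
  show "sob_mult s (r *\<^sub>R a) b = r *\<^sub>R sob_mult s a b"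
    by (rule ell2_eqI)
      (simp add: coord_sob_mult sob_conv_def sob_coeff_simps infsum_scaleR_right)
  show "sob_mult s a (r *\<^sub>R b) = r *\<^sub>R sob_mult s a b"
    by (rule ell2_eqI)
      (simp add: coord_sob_mult sob_conv_def sob_coeff_simps infsum_scaleR_right)
next
  have "norm (sob_mult s a b) \<le> norm a * norm b * sqrt conv_const" for a b :: "(int ^ 'd) ell2"
  proof (rule norm_ell2_leI)
    show "(\<Sum>k\<in>F. (cmod (coord (sob_mult s a b) k))\<^sup>2) \<le> (norm a * norm b * sqrt conv_const)\<^sup>2"
      if "finite F" for F
      using sum_sob_conv_le[OF that, of a b] by (simp add: coord_sob_mult mult.assoc mult.commute mult.left_commute)
    show "0 \<le> norm a * norm b * sqrt conv_const"
      using inv_weight_sum_nonneg by (simp add: conv_const_def)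
  qed
  then show "\<exists>K. \<forall>a b. norm (sob_mult s a b :: (int ^ 'd) ell2) \<le> norm a * norm b * K"
    by blast
qed

end

text \<open>Conjugating a function conjugates and reflects its Fourier coefficients; the weights are
  real and even, so the same rule holds for weighted coordinates.\<close>

definition sob_cnj :: "(int ^ 'd) ell2 \<Rightarrow> (int ^ 'd) ell2" where
  "sob_cnj a = Abs_ell2 (\<lambda>k. cnj (coord a (- k)))"

lemma coord_sob_cnj: "coord (sob_cnj a) k = cnj (coord a (- k))"
proof -
  have "(\<lambda>k. (cmod (coord a (- k)))\<^sup>2) summable_on UNIV"
    using summable_on_coord_sq[of a UNIV]
    by (subst summable_on_reindex_bij_betw[of uminus UNIV UNIV "\<lambda>k. (cmod (coord a k))\<^sup>2"]) (auto intro: bij_uminus)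
  then show ?thesis
    by (simp add: sob_cnj_def coord_Abs_ell2 square_summable_def)
qed

lemma norm_sob_cnj: "norm (sob_cnj a) = norm a"
proof -
  have "(norm (sob_cnj a))\<^sup>2 = (norm a)\<^sup>2"
    unfolding norm_ell2_sq coord_sob_cnj complex_mod_cnj
    by (rule infsum_reindex_bij_betw) (rule bij_uminus)
  then show ?thesis by simp
qed

lemma bounded_linear_sob_cnj: "bounded_linear sob_cnj"
  by (rule bounded_linear_intro[of _ 1])
    (auto intro!: ell2_eqI simp: coord_sob_cnj norm_sob_cnj)

section \<open>Fourier series\<close>

definition character :: "int ^ 'd \<Rightarrow> real ^ 'd \<Rightarrow> complex" where
  "character k x = exp (\<i> * of_real (real_vec k \<bullet> x))"

lemma character_simps:
  "character 0 x = 1" "character (j + k) x = character j x * character k x"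
  "character (- k) x = cnj (character k x)" "cmod (character k x) = 1"
  by (simp_all add: character_def inner_add_left ring_distribs exp_add exp_cnj)

lemma continuous_on_character [continuous_intros]: "continuous_on U (character k)"
  unfolding character_def by (intro continuous_intros)

lemma torus_fun_character:
  fixes k :: "int ^ 'd"
  shows "torus_fun (character k)"
  unfolding torus_fun_def
proof (intro allI)
  fix x :: "real ^ 'd" and m :: "int ^ 'd"
  have "real_vec k \<bullet> real_vec m = of_int (\<Sum>i\<in>UNIV. k $ i * m $ i)"
    by (simp add: inner_vec_def real_vec_def)
  then obtain n :: int where "real_vec k \<bullet> real_vec m = of_int n"
    by blast
  then have "\<i> * of_real (real_vec k \<bullet> (x + (2 * pi) *\<^sub>R real_vec m))
      = \<i> * of_real (real_vec k \<bullet> x) + 2 * of_real pi * \<i> * of_int n"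
    by (simp add: inner_add_right algebra_simps)
  then show "character k (x + (2 * pi) *\<^sub>R real_vec m) = character k x"
    using exp_plus_2pin[of "\<i> * of_real (real_vec k \<bullet> x)" n] by (simp add: character_def mult_ac)
qed

lemma integral_exp_int:
  fixes n :: int
  shows "(LINT t:{0..2 * pi}|lborel. exp (\<i> * of_real (of_int n * t))) = (if n = 0 then of_real (2 * pi) else 0)"
proof -
  have int: "set_integrable lborel {0..2 * pi} (\<lambda>t. exp (\<i> * of_real (of_int n * t)) :: complex)"
    by (intro borel_integrable_atLeastAtMost' continuous_intros)
  have "((\<lambda>t. exp (\<i> * of_real (of_int n * t)) :: complex) has_integral (if n = 0 then of_real (2 * pi) else 0)) {0..2 * pi}"
  proof (cases "n = 0")
    case True
    then show ?thesis
      using has_integral_const_real[of "1 :: complex" 0 "2 * pi"] by (simp add: scaleR_conv_of_real)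
  next
    case False
    have "((\<lambda>t. exp (\<i> * of_real (of_int n * t))) has_integral
        exp (\<i> * of_real (of_int n * (2 * pi))) / (\<i> * of_int n) - exp (\<i> * of_real (of_int n * 0)) / (\<i> * of_int n)) {0..2 * pi}"
    proof (rule fundamental_theorem_of_calculus)
      fix t
      have "((\<lambda>z. exp (\<i> * (of_int n * z)) / (\<i> * of_int n)) has_field_derivative exp (\<i> * (of_int n * of_real t))) (at (of_real t))"
        using False by (auto intro!: derivative_eq_intros simp: algebra_simps)
      from has_vector_derivative_real_field[OF this]
      show "((\<lambda>t. exp (\<i> * of_real (of_int n * t)) / (\<i> * of_int n)) has_vector_derivative exp (\<i> * of_real (of_int n * t))) (at t within {0..2 * pi})"
        by simp
    qed simp
    moreover have "exp (\<i> * of_real (of_int n * (2 * pi))) = 1"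
      using exp_integer_2pi[of "of_int n"] by (simp add: mult_ac)
    ultimately show ?thesis using False by simp
  qed
  then show ?thesis
    using set_borel_integral_eq_integral(2)[OF int] by (simp add: integral_unique)
qed

text \<open>The cube and the character both factor over the coordinates, and \<open>lborel\<close>
  is the image of a product measure, so the integral is a product of one-dimensional ones. It is
  stated for the gauge integral because termwise integration of uniform limits is used in that
  form.\<close>

lemma integral_character:
  fixes k :: "int ^ 'd"
  shows "(character k has_integral (if k = 0 then of_real ((2 * pi) ^ CARD('d)) else 0)) torus_cube"
proof -
  define f :: "real ^ 'd \<Rightarrow> real \<Rightarrow> complex"
    where "f b t = indicator {0..2 * pi} t *\<^sub>R exp (\<i> * of_real (real_vec k \<bullet> b * t))" for b t
  interpret product_sigma_finite "\<lambda>_::real ^ 'd. lborel :: real measure"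
    by standard
  have f: "integrable lborel (f b)" for b
    unfolding f_def by (intro borel_integrable_compact continuous_intros) auto
  have Basis_eq: "(Basis :: (real ^ 'd) set) = range (\<lambda>i. axis i 1)"
    by (auto simp: Basis_vec_def)
  have inner_Basis_const: "(\<chi> i. 2 * pi) \<bullet> b = 2 * pi" if "b \<in> Basis" for b :: "real ^ 'd"
    using that by (auto simp: Basis_vec_def inner_axis)
  have "indicator torus_cube x *\<^sub>R character k x = (\<Prod>b\<in>Basis. f b (x \<bullet> b))" for x
  proof -
    have "indicator torus_cube x = (\<Prod>b\<in>(Basis :: (real ^ 'd) set). indicator {0..2 * pi} (x \<bullet> b) :: real)"
    proof (cases "x \<in> torus_cube")
      case True
      then show ?thesis
        by (simp add: torus_cube_def mem_box inner_Basis_const)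
    next
      case False
      then obtain b :: "real ^ 'd" where "b \<in> Basis" "x \<bullet> b \<notin> {0..2 * pi}"
        by (auto simp: torus_cube_def mem_box inner_Basis_const)
      then show ?thesis
        using False by (auto intro!: prod_zero[symmetric] bexI[of _ b])
    qed
    moreover have "character k x = (\<Prod>b\<in>Basis. exp (\<i> * of_real ((real_vec k \<bullet> b) * (x \<bullet> b))))"
      unfolding character_def by (subst euclidean_inner) (simp add: sum_distrib_left exp_sum)
    ultimately show ?thesis
      by (simp add: f_def scaleR_conv_of_real prod.distrib)
  qed
  then have "(LINT x:torus_cube|lborel. character k x) = (\<integral>x. (\<Prod>b\<in>Basis. f b (x \<bullet> b)) \<partial>lborel)"
    by (simp add: set_lebesgue_integral_def)
  also have "\<dots> = (\<integral>g. (\<Prod>b\<in>Basis. f b ((\<Sum>c\<in>Basis. g c *\<^sub>R c) \<bullet> b)) \<partial>Pi\<^sub>M Basis (\<lambda>_. lborel))"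
    by (subst lborel_eq, subst integral_distr) (auto simp: f_def)
  also have "\<dots> = (\<integral>g. (\<Prod>b\<in>Basis. f b (g b)) \<partial>Pi\<^sub>M Basis (\<lambda>_. lborel))"
    by simp
  also have "\<dots> = (\<Prod>b\<in>Basis. integral\<^sup>L lborel (f b))"
    by (rule product_integral_prod) (auto intro: f)
  also have "\<dots> = (\<Prod>i\<in>(UNIV :: 'd set). integral\<^sup>L lborel (f (axis i 1)))"
    by (subst Basis_eq, subst prod.reindex) (auto simp: inj_on_def axis_eq_axis)
  also have "\<dots> = (\<Prod>i\<in>(UNIV :: 'd set). if k $ i = 0 then of_real (2 * pi) else 0)"
    unfolding f_def set_lebesgue_integral_def[symmetric]
    by (simp only: inner_axis real_vec_def vec_lambda_beta inner_real_def mult_1_right integral_exp_int)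
  also have "\<dots> = (if k = 0 then of_real ((2 * pi) ^ CARD('d)) else 0)"
  proof (cases "k = 0")
    case False
    then obtain i where "k $ i \<noteq> 0" by (auto simp: vec_eq_iff)
    then show ?thesis using False by (auto intro!: prod_zero)
  qed simp
  finally have "(LINT x:torus_cube|lborel. character k x) = (if k = 0 then of_real ((2 * pi) ^ CARD('d)) else 0)" .
  moreover have int: "set_integrable lborel torus_cube (character k)"
    unfolding set_integrable_def torus_cube_def
    by (intro borel_integrable_compact continuous_intros) auto
  ultimately show ?thesis
    using set_borel_integral_eq_integral[OF int] by (simp add: has_integral_iff)
qed

definition fourier_series :: "(int ^ 'd \<Rightarrow> complex) \<Rightarrow> real ^ 'd \<Rightarrow> complex" where
  "fourier_series c x = (\<Sum>\<^sub>\<infinity>k. c k * character k x)"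

lemma torus_fun_fourier_series: "torus_fun (fourier_series c)"
  by (simp add: torus_fun_def fourier_series_def torus_fun_character[unfolded torus_fun_def, rule_format])

lemma fourier_series_cmult: "fourier_series (\<lambda>k. z * c k) x = z * fourier_series c x"
  by (simp add: fourier_series_def mult.assoc infsum_cmult_right')

context
  fixes c :: "int ^ 'd \<Rightarrow> complex"
  assumes c: "(\<lambda>k. cmod (c k)) summable_on UNIV"
begin

lemma summable_fourier_series: "(\<lambda>k. c k * character k x) summable_on UNIV"
  by (rule abs_summable_summable) (simp add: norm_mult character_simps c)

lemma uniform_limit_fourier_series:
  "uniform_limit U (\<lambda>F x. \<Sum>k\<in>F. c k * character k x) (fourier_series c) (finite_subsets_at_top UNIV)"
  unfolding fourier_series_def
  by (rule Weierstrass_m_test_general[OF _ c]) (simp add: norm_mult character_simps)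

lemma continuous_on_fourier_series: "continuous_on U (fourier_series c)"
  by (rule uniform_limit_theorem[OF _ uniform_limit_fourier_series])
    (auto intro!: always_eventually continuous_intros)

text \<open>Uniform convergence permits termwise integration over the cube. By orthogonality the
  integrals of the partial sums are constant as soon as the index set contains
  \<open>k\<close>.\<close>

lemma fourier_coeff_fourier_series: "fourier_coeff (fourier_series c) k = c k"
proof -
  define N :: complex where "N = of_real ((2 * pi) ^ CARD('d))"
  let ?f = "\<lambda>F x. \<Sum>j\<in>F. c j * character (j - k) x"
  let ?g = "\<lambda>x. fourier_series c x * character (- k) x"
  have "?g = (\<lambda>x. \<Sum>\<^sub>\<infinity>j. c j * character (j - k) x)"
    using character_simps(2)[of _ "- k"]
    by (simp add: fourier_series_def mult.assoc flip: infsum_cmult_left')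
  then have "uniform_limit torus_cube ?f ?g (finite_subsets_at_top UNIV)"
    by (simp only:) (rule Weierstrass_m_test_general[OF _ c], simp add: norm_mult character_simps)
  moreover have "continuous_on torus_cube (?f F)" for F
    by (intro continuous_intros)
  ultimately obtain I J where
    I: "\<And>F. (?f F has_integral I F) torus_cube" and J: "(?g has_integral J) torus_cube"
    and lim: "(I \<longlongrightarrow> J) (finite_subsets_at_top UNIV)"
    unfolding torus_cube_def by (rule uniform_limit_integral_cbox) auto
  have I': "I F = (if k \<in> F then c k * N else 0)" if "finite F" for F
  proof -
    have "(?f F has_integral (\<Sum>j\<in>F. c j * (if j - k = 0 then N else 0))) torus_cube"
      unfolding N_def by (intro has_integral_sum that has_integral_mult_right integral_character)
    then have "I F = (\<Sum>j\<in>F. c j * (if j - k = 0 then N else 0))"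
      by (rule has_integral_unique[OF I])
    also have "\<dots> = (\<Sum>j\<in>F. if j = k then c k * N else 0)"
      by (intro sum.cong) auto
    finally show ?thesis
      using that by simp
  qed
  have "\<forall>\<^sub>F F in finite_subsets_at_top UNIV. I F = c k * N"
    unfolding eventually_finite_subsets_at_top by (rule exI[of _ "{k}"]) (auto simp: I')
  then have "J = c k * N"
    by (metis finite_subsets_at_top_neq_bot lim tendsto_eventually tendsto_unique)
  moreover have "set_integrable lborel torus_cube ?g"
    unfolding set_integrable_def torus_cube_def
    by (intro borel_integrable_compact continuous_intros continuous_on_fourier_series) auto
  ultimately have "(LINT x:torus_cube|lborel. ?g x) = c k * N"
    using J set_borel_integral_eq_integral(2) integral_unique by metis
  moreover have "exp (- \<i> * of_real (real_vec k \<bullet> x)) = character (- k) x" for x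
    by (simp add: character_def)
  ultimately show ?thesis
    by (simp add: fourier_coeff_def N_def)
qed

lemma fourier_series_cnj: "fourier_series (\<lambda>k. cnj (c (- k))) x = cnj (fourier_series c x)"
proof -
  have "fourier_series (\<lambda>k. cnj (c (- k))) x = (\<Sum>\<^sub>\<infinity>k. cnj (c (- k) * character (- k) x))"
    by (simp add: fourier_series_def character_simps)
  also have "\<dots> = (\<Sum>\<^sub>\<infinity>k. cnj (c k * character k x))"
    by (rule infsum_reindex_bij_betw) (rule bij_uminus)
  finally show ?thesis
    by (simp only: fourier_series_def infsum_cnj)
qed

lemma fourier_series_add:
  assumes "(\<lambda>k. cmod (d k)) summable_on UNIV"
  shows "fourier_series (\<lambda>k. c k + d k) x = fourier_series c x + fourier_series d x"
  unfolding fourier_series_def distrib_right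
  by (intro infsum_add summable_fourier_series abs_summable_summable[where f = "\<lambda>k. d k * character k x"])
    (simp add: norm_mult character_simps assms)

text \<open>The Cauchy product: for fixed \<open>j\<close> the sum for \<open>d\<close> is shifted
  by \<open>j\<close>, and absolute summability of the double family lets the two sums be
  interchanged.\<close>

lemma fourier_series_mult:
  assumes d: "(\<lambda>k. cmod (d k)) summable_on UNIV"
  shows "fourier_series c x * fourier_series d x = fourier_series (\<lambda>k. \<Sum>\<^sub>\<infinity>j. c j * d (k - j)) x"
proof -
  let ?A = "\<lambda>j. c j * character j x" and ?B = "\<lambda>j. d j * character j x"
  have bij: "bij (\<lambda>k. k - j)" for j :: "int ^ 'd"
    by (rule bij_betw_byWitness[where f' = "\<lambda>k. k + j"]) auto
  have B: "(\<lambda>k. cmod (?B (k - j))) summable_on UNIV"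
    "(\<Sum>\<^sub>\<infinity>k. cmod (?B (k - j))) = (\<Sum>\<^sub>\<infinity>k. cmod (?B k))" for j
    using d by (subst summable_on_reindex_bij_betw[OF bij, of "\<lambda>k. cmod (?B k)"] infsum_reindex_bij_betw[OF bij, of "\<lambda>k. cmod (?B k)"];
        simp add: norm_mult character_simps)+
  have summable: "(\<lambda>(j, k). ?A j * ?B (k - j)) summable_on UNIV \<times> UNIV"
  proof (rule abs_summable_summable, subst Infinite_Sum.abs_summable_on_Sigma_iff, intro conjI ballI)
    show "(\<lambda>k. norm (case (j, k) of (j, k) \<Rightarrow> ?A j * ?B (k - j))) summable_on UNIV" for j
      using summable_on_cmult_right[OF B(1), of "cmod (?A j)"] by (simp add: norm_mult)
    have "(\<lambda>j. cmod (?A j) * (\<Sum>\<^sub>\<infinity>k. cmod (?B k))) summable_on UNIV"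
      using c by (intro summable_on_cmult_left) (simp add: norm_mult character_simps)
    moreover have "norm (\<Sum>\<^sub>\<infinity>k. norm (case (j, k) of (j, k) \<Rightarrow> ?A j * ?B (k - j))) = cmod (?A j) * (\<Sum>\<^sub>\<infinity>k. cmod (?B k))" for j
      unfolding prod.case norm_mult[of "?A j"] infsum_cmult_right' B(2)
      by (simp add: infsum_nonneg)
    ultimately show "(\<lambda>j. norm (\<Sum>\<^sub>\<infinity>k. norm (case (j, k) of (j, k) \<Rightarrow> ?A j * ?B (k - j)))) summable_on UNIV"
      by simp
  qed
  have "fourier_series c x * fourier_series d x = (\<Sum>\<^sub>\<infinity>j. ?A j * infsum ?B UNIV)"
    by (simp add: fourier_series_def infsum_cmult_left')
  also have "\<dots> = (\<Sum>\<^sub>\<infinity>j. \<Sum>\<^sub>\<infinity>k. ?A j * ?B (k - j))"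
    by (simp only: infsum_cmult_right' infsum_reindex_bij_betw[OF bij, of ?B])
  also have "\<dots> = (\<Sum>\<^sub>\<infinity>k. \<Sum>\<^sub>\<infinity>j. ?A j * ?B (k - j))"
    by (rule infsum_swap_banach[OF summable])
  also have "\<dots> = (\<Sum>\<^sub>\<infinity>k. \<Sum>\<^sub>\<infinity>j. c j * d (k - j) * character k x)"
    using character_simps(2)[of j "k - j" x for j k] by (intro infsum_cong) (simp add: mult_ac)
  finally show ?thesis
    by (simp add: fourier_series_def infsum_cmult_left')
qed

end

section \<open>Sobolev functions as square summable families\<close>

definition synth :: "nat \<Rightarrow> (int ^ 'd) ell2 \<Rightarrow> real ^ 'd \<Rightarrow> complex" where
  "synth s a = fourier_series (sob_coeff s a)"

text \<open>The sum runs over the values, weighted by the measures of their level sets, to match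
  \<open>sobolev_simple_integral\<close>.\<close>

lemma has_integral_finite_range:
  fixes H :: "real \<Rightarrow> 'a::banach"
  assumes fin: "finite (H ` {a..b})"
    and sets: "\<And>h. h \<in> H ` {a..b} \<Longrightarrow> {\<tau>\<in>{a..b}. H \<tau> = h} \<in> sets borel"
  shows "(H has_integral (\<Sum>h\<in>H ` {a..b}. measure lborel {\<tau>\<in>{a..b}. H \<tau> = h} *\<^sub>R h)) {a..b}"
proof (rule has_integral_eq)
  let ?A = "\<lambda>h. {\<tau>\<in>{a..b}. H \<tau> = h}"
  show "((\<lambda>\<tau>. \<Sum>h\<in>H ` {a..b}. if \<tau> \<in> ?A h then 1 *\<^sub>R h else 0) has_integral
      (\<Sum>h\<in>H ` {a..b}. measure lborel (?A h) *\<^sub>R h)) {a..b}"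
  proof (rule has_integral_sum[OF fin])
    fix h
    assume h: "h \<in> H ` {a..b}"
    have "emeasure lborel (?A h) \<le> emeasure lborel {a..b}"
      by (rule emeasure_mono) auto
    also have "\<dots> < \<infinity>"
      by (cases "a \<le> b") auto
    finally have "((\<lambda>_. 1 :: real) has_integral measure lborel (?A h)) (?A h)"
      by (intro has_integral_measure_lborel sets h)
    then have "((\<lambda>_. 1 *\<^sub>R h) has_integral measure lborel (?A h) *\<^sub>R h) (?A h)"
      by (rule has_integral_scaleR_left)
    then show "((\<lambda>\<tau>. if \<tau> \<in> ?A h then 1 *\<^sub>R h else 0) has_integral measure lborel (?A h) *\<^sub>R h) {a..b}"
      by (subst has_integral_restrict) auto
  qed
  show "(\<Sum>h\<in>H ` {a..b}. if \<tau> \<in> ?A h then 1 *\<^sub>R h else 0) = H \<tau>" if "\<tau> \<in> {a..b}" for \<tau>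
    using that fin by (simp add: sum.delta)
qed

text \<open>Rounds down to a multiple of \<open>1 / real (Suc n)\<close>. Rounding down keeps the
  times of \<open>{0..t}\<close> inside this interval even if \<open>t\<close> is not a grid
  point.\<close>

definition lower_step :: "nat \<Rightarrow> real \<Rightarrow> real" where
  "lower_step n \<tau> = of_int \<lfloor>real (Suc n) * \<tau>\<rfloor> / real (Suc n)"

lemma lower_step_le: "lower_step n \<tau> \<le> \<tau>"
  by (simp add: lower_step_def divide_le_eq mult.commute)

lemma lower_step_ge: "\<tau> - 1 / real (Suc n) \<le> lower_step n \<tau>"
proof -
  have "real (Suc n) * \<tau> - 1 \<le> of_int \<lfloor>real (Suc n) * \<tau>\<rfloor>" by linarith
  then have "(real (Suc n) * \<tau> - 1) / real (Suc n) \<le> lower_step n \<tau>"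
    unfolding lower_step_def by (intro divide_right_mono) auto
  then show ?thesis
    by (simp add: diff_divide_distrib del: of_nat_Suc)
qed

lemma lower_step_in_Icc: "\<tau> \<in> {0..t} \<Longrightarrow> lower_step n \<tau> \<in> {0..t}"
  using lower_step_le[of n \<tau>] by (auto simp: lower_step_def)

lemma borel_measurable_lower_step [measurable]: "lower_step n \<in> borel_measurable borel"
  unfolding lower_step_def by measurable

lemma finite_lower_step: "finite (lower_step n ` {0..t})"
proof (rule finite_subset)
  show "lower_step n ` {0..t} \<subseteq> (\<lambda>i. of_int i / real (Suc n)) ` {0..\<lfloor>real (Suc n) * t\<rfloor>}"
    by (auto simp: lower_step_def intro!: imageI floor_mono mult_left_mono simp del: of_nat_Suc)
qed simp

text \<open>On \<open>{0..t}\<close> the rounding takes finitely many values, so an arbitrary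
  \<open>P\<close> only selects a finite, hence closed, set of them.\<close>

lemma sets_lower_step: "{\<tau>\<in>{0..t}. P (lower_step n \<tau>)} \<in> sets borel"
proof -
  have "lower_step n -` (lower_step n ` {0..t} \<inter> Collect P) \<inter> space borel \<in> sets borel"
    by (rule measurable_sets[OF borel_measurable_lower_step])
      (intro borel_closed finite_imp_closed finite_Int disjI1 finite_lower_step)
  then have "{0..t} \<inter> lower_step n -` (lower_step n ` {0..t} \<inter> Collect P) \<in> sets borel"
    by simp
  also have "{0..t} \<inter> lower_step n -` (lower_step n ` {0..t} \<inter> Collect P) = {\<tau>\<in>{0..t}. P (lower_step n \<tau>)}"
    by auto
  finally show ?thesis .
qed

section \<open>Transfer between functions and weighted coefficients\<close>

context sobolev_algebra
begin

lemma continuous_on_synth: "continuous_on U (synth s (a :: (int ^ 'd) ell2))"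
  unfolding synth_def by (rule continuous_on_fourier_series[OF abs_summable_sob_coeff])

lemma fourier_coeff_synth: "fourier_coeff (synth s a) k = sob_coeff s a (k :: int ^ 'd)"
  unfolding synth_def by (rule fourier_coeff_fourier_series[OF abs_summable_sob_coeff])

lemma sobolev_term_synth: "sobolev_term s (synth s a) k = (cmod (coord a (k :: int ^ 'd)))\<^sup>2"
  by (simp add: sobolev_term_def fourier_coeff_synth norm_sob_coeff power_divide flip: weight_def)

lemma synth_in_sobolev: "synth s (a :: (int ^ 'd) ell2) \<in> sobolev s"
proof -
  have "set_integrable lborel torus_cube (\<lambda>x. (cmod (synth s a x))\<^sup>2)"
    unfolding set_integrable_def torus_cube_def
    by (intro borel_integrable_compact continuous_intros continuous_on_synth) auto
  moreover have "sobolev_term s (synth s a) summable_on UNIV"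
    by (subst summable_on_cong[OF sobolev_term_synth]) (rule summable_on_coord_sq)
  moreover have "torus_fun (synth s a)"
    by (simp add: synth_def torus_fun_fourier_series)
  ultimately show ?thesis
    by (simp add: sobolev_def borel_measurable_continuous_onI continuous_on_synth)
qed

lemma sobolev_norm_synth: "sobolev_norm s (synth s a) = norm (a :: (int ^ 'd) ell2)"
  by (simp add: sobolev_norm_def sobolev_term_synth norm_ell2_sq[symmetric])

lemma synth_add: "synth s (a + b) x = synth s a x + synth s (b :: (int ^ 'd) ell2) x"
  unfolding synth_def sob_coeff_simps by (intro fourier_series_add abs_summable_sob_coeff)

lemma synth_cmult: "synth s (ell2_mult (\<lambda>_. z) a) x = z * synth s (a :: (int ^ 'd) ell2) x"
proof -
  have "sob_coeff s (ell2_mult (\<lambda>_. z) a) = (\<lambda>k. z * sob_coeff s a k)"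
    by (simp add: fun_eq_iff sob_coeff_def coord_ell2_mult[where B = "cmod z"])
  then show ?thesis
    by (simp add: synth_def fourier_series_cmult)
qed

lemma synth_scaleR: "synth s (r *\<^sub>R a) x = r *\<^sub>R synth s (a :: (int ^ 'd) ell2) x"
  unfolding synth_def sob_coeff_simps scaleR_conv_of_real
  by (rule fourier_series_cmult)

lemma synth_diff: "synth s (a - b) x = synth s a x - synth s (b :: (int ^ 'd) ell2) x"
  using synth_add[of a "(-1) *\<^sub>R b" x] synth_scaleR[of "-1" b x] by simp

lemma synth_sum: "synth s (\<Sum>i\<in>I. f i) x = (\<Sum>i\<in>I. synth s (f i :: (int ^ 'd) ell2) x)"
proof (induction I rule: infinite_finite_induct)
  case empty
  show ?case using synth_scaleR[of 0 0 x] by simp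
next
  case infinite
  then show ?case using synth_scaleR[of 0 0 x] by simp
qed (simp add: synth_add)

text \<open>By injectivity a step function and its image under \<open>synth\<close> have the same
  level sets, so the sums over their ranges correspond.\<close>

lemma inj_synth: "inj (synth s :: (int ^ 'd) ell2 \<Rightarrow> _)"
proof (rule injI)
  fix a b :: "(int ^ 'd) ell2"
  assume "synth s a = synth s b"
  then have "sob_coeff s a k = sob_coeff s b k" for k
    by (simp flip: fourier_coeff_synth)
  then show "a = b"
    by (intro ell2_eqI) (simp add: sob_coeff_def)
qed

lemma synth_sob_mult: "synth s (sob_mult s a b) x = synth s a x * synth s (b :: (int ^ 'd) ell2) x"
proof -
  have "sob_coeff s (sob_mult s a b) = (\<lambda>k. \<Sum>\<^sub>\<infinity>j. sob_coeff s a j * sob_coeff s b (k - j))"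
    by (simp add: fun_eq_iff sob_coeff_sob_mult sob_conv_def)
  then show ?thesis
    by (simp add: synth_def fourier_series_mult abs_summable_sob_coeff)
qed

lemma synth_sob_cnj: "synth s (sob_cnj a) x = cnj (synth s (a :: (int ^ 'd) ell2) x)"
proof -
  have "sob_coeff s (sob_cnj a) = (\<lambda>k. cnj (sob_coeff s a (- k)))"
    by (simp add: fun_eq_iff sob_coeff_def coord_sob_cnj)
  then show ?thesis
    by (simp add: synth_def fourier_series_cnj abs_summable_sob_coeff)
qed

text \<open>Only the coefficients of \<open>f\<close> are matched: \<open>f\<close> may differ from
  the continuous representative \<open>synth s a\<close>. This is enough because
  \<open>cgl_semigroup\<close> sees the initial datum only through its coefficients.\<close>

lemma sobolev_obtain_ell2:
  assumes "f \<in> sobolev s"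
  obtains a :: "(int ^ 'd) ell2" where "\<And>k. fourier_coeff f k = sob_coeff s a k"
proof -
  define c where "c k = of_real (sqrt (weight s k)) * fourier_coeff f k" for k :: "int ^ 'd"
  have "(cmod (c k))\<^sup>2 = sobolev_term s f k" for k
    by (simp add: c_def norm_mult power_mult_distrib sobolev_term_def weight_def)
  then have "square_summable c"
    using assms by (simp add: square_summable_def sobolev_def)
  then have "fourier_coeff f k = sob_coeff s (Abs_ell2 c) k" for k
    by (simp add: sob_coeff_def coord_Abs_ell2 c_def)
  then show thesis by (rule that)
qed

text \<open>\<open>H n\<close> samples \<open>F\<close> at the grid points of
  \<open>lower_step n\<close>. Uniform continuity of \<open>F\<close> makes \<open>e n\<close> small
  uniformly on \<open>{0..t}\<close>, and its integral dominates the difference of the integrals as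
  well, so both limits in the definition follow from \<open>lim\<close>.\<close>

theorem has_sobolev_integral_synth:
  fixes F :: "real \<Rightarrow> (int ^ 'd) ell2"
  assumes F: "continuous_on {0..t} F" and t: "0 \<le> t"
  shows "has_sobolev_integral s (\<lambda>\<tau>. synth s (F \<tau>)) (synth s (integral {0..t} F)) {0..t}"
proof -
  define H where "H n \<tau> = F (lower_step n \<tau>)" for n \<tau>
  define e where "e n \<tau> = norm (F \<tau> - H n \<tau>)" for n \<tau>
  have fin: "finite (H n ` {0..t})" for n
    using finite_imageI[OF finite_lower_step[of n t], of F] by (simp add: H_def image_image)
  have sets: "{\<tau>\<in>{0..t}. H n \<tau> = h} \<in> sets borel" for n h
    unfolding H_def by (rule sets_lower_step)
  have simple: "sobolev_simple s {0..t} (\<lambda>\<tau>. synth s (H n \<tau>))" for n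
  proof -
    have "(\<lambda>\<tau>. synth s (H n \<tau>)) ` {0..t} = synth s ` H n ` {0..t}"
      by (simp add: image_image)
    then show ?thesis
      using fin[of n] sets[of n]
      by (auto simp: sobolev_simple_def synth_in_sobolev inj_eq[OF inj_synth])
  qed
  have e_eq: "sobolev_norm s (\<lambda>x. synth s (F \<tau>) x - synth s (H n \<tau>) x) = e n \<tau>" for n \<tau>
    by (simp add: e_def sobolev_norm_synth flip: synth_diff)
  have e_int: "set_integrable lborel {0..t} (e n)" for n
  proof -
    \<comment> \<open>A continuous extension of \<open>F\<close> to the line. Composed with the
      Borel function \<open>lower_step n\<close> it is measurable, and on \<open>{0..t}\<close> it
      agrees with \<open>F\<close>.\<close>
    define F' where "F' \<tau> = F (max 0 (min t \<tau>))" for \<tau>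
    have F': "continuous_on UNIV F'"
      unfolding F'_def using t by (intro continuous_on_compose2[OF F] continuous_intros) auto
    have "(\<lambda>\<tau>. norm (F' \<tau> - F' (lower_step n \<tau>))) \<in> borel_measurable borel"
      by (rule borel_measurable_continuous_Pair[where H = "\<lambda>x y. norm (F' x - F' y)"])
        (auto intro!: continuous_intros continuous_on_compose2[OF F'])
    moreover obtain B where "\<forall>b\<in>F ` {0..t}. norm b \<le> B"
      using compact_imp_bounded[OF compact_continuous_image[OF F compact_Icc]] unfolding bounded_iff by blast
    then have B: "norm (F \<tau>) \<le> B" if "\<tau> \<in> {0..t}" for \<tau>
      using that by blast
    have "norm (F' \<tau> - F' (lower_step n \<tau>)) \<le> 2 * B" if "\<tau> \<in> {0..t}" for \<tau>
      using norm_triangle_ineq4[of "F' \<tau>" "F' (lower_step n \<tau>)"] B[of "max 0 (min t \<tau>)"]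
        B[of "max 0 (min t (lower_step n \<tau>))"] t by (simp add: F'_def)
    ultimately have "set_integrable lborel {0..t} (\<lambda>\<tau>. norm (F' \<tau> - F' (lower_step n \<tau>)))"
      unfolding set_integrable_def
      by (intro integrableI_bounded_set_indicator[where B = "2 * B"]) (auto simp: t)
    moreover have "F' \<tau> = F \<tau>" "F' (lower_step n \<tau>) = H n \<tau>" if "\<tau> \<in> {0..t}" for \<tau>
      using that lower_step_in_Icc[OF that, of n] by (auto simp: F'_def H_def)
    ultimately show ?thesis
      unfolding e_def by (subst (asm) set_integrable_cong) auto
  qed
  note e_int' = set_borel_integral_eq_integral[OF e_int]
  have lim: "(\<lambda>n. integral {0..t} (e n)) \<longlonglongrightarrow> 0"
  proof (rule LIMSEQ_I)
    fix r :: real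
    assume "r > 0"
    \<comment> \<open>Dividing by \<open>t + 1\<close> covers \<open>t = 0\<close> as well.\<close>
    define \<epsilon> where "\<epsilon> = r / (t + 1)"
    have \<epsilon>: "\<epsilon> > 0" "\<epsilon> * t < r"
      using \<open>r > 0\<close> t by (auto simp: \<epsilon>_def field_simps)
    obtain \<delta> where \<delta>: "\<delta> > 0"
      "\<And>x y. x \<in> {0..t} \<Longrightarrow> y \<in> {0..t} \<Longrightarrow> dist y x < \<delta> \<Longrightarrow> dist (F y) (F x) < \<epsilon>"
      using compact_uniformly_continuous[OF F compact_Icc] \<epsilon>(1) unfolding uniformly_continuous_on_def by metis
    obtain N where N: "1 / real (Suc N) < \<delta>"
      using reals_Archimedean[OF \<delta>(1)] by (auto simp: inverse_eq_divide)
    have "norm (integral {0..t} (e n) - 0) < r" if "n \<ge> N" for n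
    proof -
      have "e n \<tau> \<le> \<epsilon>" if \<tau>: "\<tau> \<in> {0..t}" for \<tau>
      proof -
        have "1 / real (Suc n) \<le> 1 / real (Suc N)"
          using \<open>n \<ge> N\<close> by (intro divide_left_mono) auto
        then have "dist \<tau> (lower_step n \<tau>) < \<delta>"
          using lower_step_le[of n \<tau>] lower_step_ge[of \<tau> n] N by (simp add: dist_real_def)
        then show ?thesis
          unfolding e_def H_def dist_norm[symmetric]
          by (intro less_imp_le \<delta>(2) \<tau> lower_step_in_Icc)
      qed
      then have "integral {0..t} (e n) \<le> integral {0..t} (\<lambda>_. \<epsilon>)"
        by (intro integral_le e_int') auto
      moreover have "0 \<le> integral {0..t} (e n)"
        by (intro integral_nonneg e_int') (simp add: e_def)
      ultimately show ?thesis
        using \<epsilon>(2) t by (simp add: mult.commute)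
    qed
    then show "\<exists>N. \<forall>n\<ge>N. norm (integral {0..t} (e n) - 0) < r" by blast
  qed
  have H_int: "(H n has_integral (\<Sum>h\<in>H n ` {0..t}. measure lborel {\<tau>\<in>{0..t}. H n \<tau> = h} *\<^sub>R h)) {0..t}" for n
    by (rule has_integral_finite_range[OF fin sets])
  have simple_integral: "sobolev_simple_integral {0..t} (\<lambda>\<tau>. synth s (H n \<tau>)) x = synth s (integral {0..t} (H n)) x" for n x
  proof -
    have "sobolev_simple_integral {0..t} (\<lambda>\<tau>. synth s (H n \<tau>)) x
        = (\<Sum>h\<in>synth s ` H n ` {0..t}. measure lborel {\<tau>\<in>{0..t}. synth s (H n \<tau>) = h} *\<^sub>R h x)"
      by (simp add: sobolev_simple_integral_def image_image)
    also have "\<dots> = (\<Sum>h\<in>H n ` {0..t}. measure lborel {\<tau>\<in>{0..t}. H n \<tau> = h} *\<^sub>R synth s h x)"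
      by (subst sum.reindex) (auto simp: inj_eq[OF inj_synth] intro: inj_on_subset[OF inj_synth])
    finally show ?thesis
      by (simp add: integral_unique[OF H_int] synth_sum synth_scaleR)
  qed
  have "norm (integral {0..t} (H n) - integral {0..t} F) \<le> integral {0..t} (e n)" for n
  proof -
    have F_int: "F integrable_on {0..t}"
      by (rule integrable_continuous_interval[OF F])
    have "norm (integral {0..t} (\<lambda>\<tau>. F \<tau> - H n \<tau>)) \<le> integral {0..t} (e n)"
      by (intro integral_norm_bound_integral integrable_diff F_int has_integral_integrable[OF H_int] e_int')
        (simp add: e_def)
    then show ?thesis
      by (simp add: integral_diff[OF F_int has_integral_integrable[OF H_int]] norm_minus_commute)
  qed
  then have lim': "(\<lambda>n. norm (integral {0..t} (H n) - integral {0..t} F)) \<longlonglongrightarrow> 0"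
    by (intro Lim_null_comparison[OF _ lim] always_eventually) auto
  show ?thesis
    unfolding has_sobolev_integral_def
  proof (intro conjI ballI synth_in_sobolev exI[of _ "\<lambda>n \<tau>. synth s (H n \<tau>)"] allI simple)
    show "set_integrable lborel {0..t} (\<lambda>\<tau>. sobolev_norm s (\<lambda>x. synth s (F \<tau>) x - synth s (H n \<tau>) x))" for n
      unfolding e_eq by (rule e_int)
    show "(\<lambda>n. LINT \<tau>:{0..t}|lborel. sobolev_norm s (\<lambda>x. synth s (F \<tau>) x - synth s (H n \<tau>) x)) \<longlonglongrightarrow> 0"
      unfolding e_eq e_int'(2) by (rule lim)
    show "(\<lambda>n. sobolev_norm s (\<lambda>x. sobolev_simple_integral {0..t} (\<lambda>\<tau>. synth s (H n \<tau>)) x - synth s (integral {0..t} F) x)) \<longlonglongrightarrow> 0"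
      using lim' by (simp add: simple_integral sobolev_norm_synth flip: synth_diff)
  qed
qed

end

section \<open>The controlled equation\<close>

text \<open>The difference of products is split as for the product rule. Both factors are bounded on
  the ball, because the norm of a Lipschitz function exceeds that of its value at the centre by at
  most its constant times \<open>M\<close>.\<close>

lemma (in bounded_bilinear) lipschitz_on_cball_prod:
  fixes f :: "'e::real_normed_vector \<Rightarrow> 'a" and g :: "'e \<Rightarrow> 'b"
  assumes f: "L-lipschitz_on (cball 0 M) f" and g: "K-lipschitz_on (cball 0 M) g" and M: "0 \<le> M"
  obtains C where "C-lipschitz_on (cball 0 M :: 'e set) (\<lambda>x. prod (f x) (g x))"
proof -
  obtain B where B: "0 \<le> B" "\<And>a b. norm (prod a b) \<le> norm a * norm b * B"
    using nonneg_bounded by blast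
  have bound: "norm (h x) \<le> norm (h 0) + C * M"
    if "C-lipschitz_on (cball 0 M) h" "x \<in> cball 0 M" for C x and h :: "'e \<Rightarrow> 'z::real_normed_vector"
  proof -
    have "norm (h x) \<le> norm (h 0) + norm (h x - h 0)"
      by (rule norm_triangle_sub)
    also have "norm (h x - h 0) \<le> C * norm (x - 0)"
      using that M by (intro lipschitz_on_normD[OF that(1)]) auto
    also have "C * norm (x - 0) \<le> C * M"
      using that(2) lipschitz_on_nonneg[OF that(1)] by (intro mult_left_mono) auto
    finally show ?thesis by simp
  qed
  define F where "F = norm (f 0) + L * M"
  define G where "G = norm (g 0) + K * M"
  have nonneg: "0 \<le> L" "0 \<le> K" "0 \<le> F" "0 \<le> G"
    using lipschitz_on_nonneg[OF f] lipschitz_on_nonneg[OF g] M by (auto simp: F_def G_def)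
  show thesis
  proof (rule that, rule lipschitz_onI)
    fix x y :: 'e
    assume xy: "x \<in> cball 0 M" "y \<in> cball 0 M"
    have "dist (prod (f x) (g x)) (prod (f y) (g y)) = norm (prod (f x - f y) (g x) + prod (f y) (g x - g y))"
      by (simp add: dist_norm diff_left diff_right)
    also have "\<dots> \<le> norm (f x - f y) * norm (g x) * B + norm (f y) * norm (g x - g y) * B"
      by (rule order_trans[OF norm_triangle_ineq add_mono[OF B(2) B(2)]])
    also have "\<dots> \<le> (L * norm (x - y)) * G * B + F * (K * norm (x - y)) * B"
      unfolding F_def G_def using B(1) nonneg M
      by (intro add_mono mult_mono order_refl bound[OF f] bound[OF g] xy
          lipschitz_on_normD[OF f] lipschitz_on_normD[OF g]) (auto simp: G_def)
    also have "\<dots> = (L * G * B + F * K * B) * dist x y"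
      by (simp add: dist_norm algebra_simps)
    finally show "dist (prod (f x) (g x)) (prod (f y) (g y)) \<le> (L * G * B + F * K * B) * dist x y" .
  qed (use B(1) nonneg in simp)
qed

text \<open>Represents |psi|^(2 n) psi. The even exponent makes this a polynomial in psi and its
  conjugate, built from \<open>sob_mult\<close> and \<open>sob_cnj\<close> alone.\<close>

primrec sob_power :: "nat \<Rightarrow> nat \<Rightarrow> (int ^ 'd) ell2 \<Rightarrow> (int ^ 'd) ell2" where
  "sob_power s 0 a = a"
| "sob_power s (Suc n) a = sob_mult s (sob_mult s a (sob_cnj a)) (sob_power s n a)"

context sobolev_algebra
begin

lemma synth_sob_power:
  "synth s (sob_power s n a) x = of_real (cmod (synth s a x) ^ (2 * n)) * synth s (a :: (int ^ 'd) ell2) x"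
  by (induction n)
    (simp_all add: synth_sob_mult synth_sob_cnj complex_norm_square[symmetric] power2_eq_square)

lemma sob_power_zero: "sob_power s n 0 = (0 :: (int ^ 'd) ell2)"
  by (induction n)
    (simp_all add: bounded_bilinear.zero_right[OF bounded_bilinear_sob_mult])

lemma sob_power_lipschitz:
  assumes "0 \<le> M"
  shows "\<exists>L. L-lipschitz_on (cball 0 M) (sob_power s n :: (int ^ 'd) ell2 \<Rightarrow> _)"
proof (induction n)
  case 0
  have "1-lipschitz_on (cball 0 M) (\<lambda>a :: (int ^ 'd) ell2. a)"
    by (rule lipschitz_onI) auto
  then show ?case by auto
next
  case (Suc n)
  then obtain K where K: "K-lipschitz_on (cball 0 M) (sob_power s n :: (int ^ 'd) ell2 \<Rightarrow> _)"
    by blast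
  have id: "1-lipschitz_on (cball 0 M) (\<lambda>a :: (int ^ 'd) ell2. a)"
    by (rule lipschitz_onI) auto
  have cnj: "1-lipschitz_on (cball 0 M) (sob_cnj :: (int ^ 'd) ell2 \<Rightarrow> _)"
    by (rule lipschitz_onI)
      (simp_all add: dist_norm norm_sob_cnj linear_diff[OF bounded_linear.linear[OF bounded_linear_sob_cnj], symmetric])
  note prod = bounded_bilinear.lipschitz_on_cball_prod[OF bounded_bilinear_sob_mult]
  obtain C where "C-lipschitz_on (cball 0 M) (\<lambda>a :: (int ^ 'd) ell2. sob_mult s a (sob_cnj a))"
    using prod[OF id cnj assms] by blast
  then obtain D where "D-lipschitz_on (cball 0 M) (\<lambda>a :: (int ^ 'd) ell2. sob_mult s (sob_mult s a (sob_cnj a)) (sob_power s n a))"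
    using prod[OF _ K assms] by blast
  then show ?case by auto
qed

end

text \<open>The factor exp (t z) comes out of the integral, which leaves the product of an
  exponential and an indefinite integral of a continuous function.\<close>

lemma duhamel_has_vector_derivative:
  fixes z :: complex
  assumes f: "continuous_on {0..T} f" and t: "t \<in> {0..T}"
    and \<phi>: "\<And>t. t \<in> {0..T} \<Longrightarrow>
      \<phi> t = exp (of_real t * z) * x + integral {0..t} (\<lambda>\<tau>. exp (of_real (t - \<tau>) * z) * f \<tau>)"
  shows "(\<phi> has_vector_derivative z * \<phi> t + f t) (at t within {0..T})"
proof -
  let ?E = "\<lambda>t. exp (of_real t * z)"
  let ?I = "\<lambda>t. integral {0..t} (\<lambda>\<tau>. ?E (- \<tau>) * f \<tau>)"
  have eq: "\<phi> t = ?E t * (x + ?I t)" if "t \<in> {0..T}" for t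
  proof -
    have "(\<lambda>\<tau>. ?E (t - \<tau>) * f \<tau>) = (\<lambda>\<tau>. ?E t * (?E (- \<tau>) * f \<tau>))"
      by (simp add: left_diff_distrib exp_diff exp_minus divide_inverse mult.assoc)
    then show ?thesis
      unfolding \<phi>[OF that] by (simp only: integral_mult_right distrib_left)
  qed
  have E: "(?E has_vector_derivative z * ?E t) (at t within {0..T})"
  proof -
    have "((\<lambda>w. exp (w * z)) has_field_derivative z * exp (of_real t * z)) (at (of_real t))"
      by (auto intro!: derivative_eq_intros)
    then show ?thesis
      by (rule has_vector_derivative_real_field)
  qed
  have I: "(?I has_vector_derivative ?E (- t) * f t) (at t within {0..T})"
    by (intro integral_has_vector_derivative continuous_intros f t)
  have "((\<lambda>t. ?E t * (x + ?I t)) has_vector_derivative ?E t * (0 + ?E (- t) * f t) + z * ?E t * (x + ?I t)) (at t within {0..T})"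
    by (intro has_vector_derivative_mult E has_vector_derivative_add has_vector_derivative_const I)
  also have "?E t * (0 + ?E (- t) * f t) + z * ?E t * (x + ?I t) = z * \<phi> t + f t"
    by (simp add: eq[OF t] exp_minus)
  finally show ?thesis
    by (rule has_vector_derivative_transform[OF t eq, rotated])
qed

text \<open>The fundamental theorem of calculus for
  \<open>exp (of_real (t - \<tau>) * z) * \<phi> \<tau>\<close>, in whose derivative the terms with
  \<open>z\<close> cancel. As \<open>z\<close> and \<open>g\<close> are free, it can be applied with
  a generator other than the one from which \<open>\<phi>\<close> was constructed.\<close>

lemma has_vector_derivative_duhamel:
  fixes z :: complex
  assumes \<phi>: "\<And>t. t \<in> {0..T} \<Longrightarrow> (\<phi> has_vector_derivative z * \<phi> t + g t) (at t within {0..T})"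
    and t: "t \<in> {0..T}"
  shows "((\<lambda>\<tau>. exp (of_real (t - \<tau>) * z) * g \<tau>) has_integral \<phi> t - exp (of_real t * z) * \<phi> 0) {0..t}"
proof -
  have "((\<lambda>\<tau>. exp (of_real (t - \<tau>) * z) * (z * \<phi> \<tau> + g \<tau>) + - z * exp (of_real (t - \<tau>) * z) * \<phi> \<tau>)
      has_integral exp (of_real (t - t) * z) * \<phi> t - exp (of_real (t - 0) * z) * \<phi> 0) {0..t}"
  proof (rule fundamental_theorem_of_calculus)
    fix \<tau>
    assume \<tau>: "\<tau> \<in> {0..t}"
    have "((\<lambda>w. exp ((of_real t - w) * z)) has_field_derivative - z * exp ((of_real t - of_real \<tau>) * z)) (at (of_real \<tau>))"
      by (auto intro!: derivative_eq_intros)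
    then have "((\<lambda>\<tau>. exp (of_real (t - \<tau>) * z)) has_vector_derivative - z * exp (of_real (t - \<tau>) * z)) (at \<tau> within {0..t})"
      using has_vector_derivative_real_field by fastforce
    moreover have "(\<phi> has_vector_derivative z * \<phi> \<tau> + g \<tau>) (at \<tau> within {0..t})"
      using \<phi>[of \<tau>] \<tau> t by (auto intro: has_vector_derivative_within_subset)
    ultimately show "((\<lambda>\<tau>. exp (of_real (t - \<tau>) * z) * \<phi> \<tau>) has_vector_derivative
        exp (of_real (t - \<tau>) * z) * (z * \<phi> \<tau> + g \<tau>) + - z * exp (of_real (t - \<tau>) * z) * \<phi> \<tau>) (at \<tau> within {0..t})"
      by (rule has_vector_derivative_mult)
  qed (use t in auto)
  then show ?thesis
    by (simp add: algebra_simps)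
qed

lemma has_sobolev_integral_cong:
  assumes "\<And>\<tau>. \<tau> \<in> I \<Longrightarrow> F \<tau> = F' \<tau>"
  shows "has_sobolev_integral s F g I \<longleftrightarrow> has_sobolev_integral s F' g I"
proof -
  have eq: "(indicator I \<tau> *\<^sub>R sobolev_norm s (\<lambda>x. F \<tau> x - G \<tau> x) :: real)
      = indicator I \<tau> *\<^sub>R sobolev_norm s (\<lambda>x. F' \<tau> x - G \<tau> x)" for G \<tau>
    using assms by (auto simp: indicator_def)
  show ?thesis
    unfolding has_sobolev_integral_def set_integrable_def set_lebesgue_integral_def eq
    using assms by (simp cong: ball_cong)
qed

text \<open>The intended symbols are unbounded and only their real parts are bounded above, so the
  multiplier is controlled for \<open>t \<ge> 0\<close> alone.\<close>

definition ell2_exp :: "('i \<Rightarrow> complex) \<Rightarrow> real \<Rightarrow> 'i ell2 \<Rightarrow> 'i ell2" where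
  "ell2_exp z t = ell2_mult (\<lambda>i. exp (of_real t * z i))"

context
  fixes z :: "'i \<Rightarrow> complex" and r :: real
  assumes r: "\<And>i. Re (z i) \<le> r"
begin

lemma norm_exp_of_real_mult_le: "0 \<le> t \<Longrightarrow> cmod (exp (of_real t * z i)) \<le> exp (r * t)"
  using mult_left_mono[OF r[of i], of t] by (simp add: mult.commute)

lemma coord_ell2_exp: "0 \<le> t \<Longrightarrow> coord (ell2_exp z t a) i = exp (of_real t * z i) * coord a i"
  unfolding ell2_exp_def by (rule coord_ell2_mult) (rule norm_exp_of_real_mult_le)

lemma norm_ell2_exp_le: "0 \<le> t \<Longrightarrow> norm (ell2_exp z t a) \<le> exp (r * t) * norm a"
  unfolding ell2_exp_def by (rule norm_ell2_mult_le) (rule norm_exp_of_real_mult_le)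

lemma bounded_linear_ell2_exp: "0 \<le> t \<Longrightarrow> bounded_linear (ell2_exp z t)"
  unfolding ell2_exp_def by (rule bounded_linear_ell2_mult) (rule norm_exp_of_real_mult_le)

text \<open>The bound \<open>r\<close> may have either sign, so the estimate \<open>B\<close> of the
  exponent on \<open>U\<close> is left to the caller: 0 in the case of decay,
  \<open>\<bar>r\<bar>\<close> times the final time in the general case.\<close>

lemma continuous_on_ell2_exp:
  assumes "continuous_on U f" "continuous_on U g" "\<And>x. x \<in> U \<Longrightarrow> 0 \<le> f x"
    and B: "\<And>x. x \<in> U \<Longrightarrow> r * f x \<le> B"
  shows "continuous_on U (\<lambda>x. ell2_exp z (f x) (g x))"
  unfolding ell2_exp_def
proof (rule continuous_on_ell2_mult[where B = "exp B"])
  fix x i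
  assume "x \<in> U"
  then show "cmod (exp (of_real (f x) * z i)) \<le> exp B"
    using norm_exp_of_real_mult_le[of "f x" i] assms(3) B by (meson exp_le_cancel_iff order_trans)
qed (intro continuous_intros assms)+

end

lemma crit_index_less:
  assumes "crit_index d \<le> s"
  shows "real d < 2 * real s"
proof -
  obtain n where "real d / 2 < real n"
    using reals_Archimedean2 by blast
  then have "real d / 2 < real (crit_index d)"
    unfolding crit_index_def by (rule LeastI)
  then show ?thesis
    using assms by simp
qed

lemma L2_control_const: "L2_control T (\<lambda>_. u)"
  unfolding L2_control_def set_borel_measurable_def set_integrable_def
  by (auto intro!: borel_measurable_indicator borel_measurable_scaleR integrable_real_mult_indicator
      simp: emeasure_lborel_Icc_eq)

text \<open>
  Coordinatewise, both Duhamel formulas express one and the same scalar differential equation.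
\<close>

lemma duhamel_change_generator:
  fixes z m :: "'i \<Rightarrow> complex" and l :: complex and a :: real
  assumes z: "\<And>i. z i = m i - l + of_real a" "\<And>i. Re (z i) \<le> p" "\<And>i. Re (m i) \<le> r"
    and n: "continuous_on {0..T} n"
    and \<phi>: "\<And>t. t \<in> {0..T} \<Longrightarrow> \<phi> t = ell2_exp z t x + integral {0..t} (\<lambda>\<tau>. ell2_exp z (t - \<tau>) (exp (a * \<tau>) *\<^sub>R n \<tau>))"
    and \<psi>: "\<And>t. \<psi> t = exp (- a * t) *\<^sub>R \<phi> t" "continuous_on {0..T} \<psi>"
    and t: "t \<in> {0..T}"
  shows "((\<lambda>\<tau>. ell2_exp m (t - \<tau>) (n \<tau> - ell2_mult (\<lambda>_. l) (\<psi> \<tau>))) has_integral \<psi> t - ell2_exp m t x) {0..t}"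
proof -
  let ?F = "\<lambda>\<tau>. ell2_exp m (t - \<tau>) (n \<tau> - ell2_mult (\<lambda>_. l) (\<psi> \<tau>))"
  have coord_l: "coord (ell2_mult (\<lambda>_. l) b) i = l * coord b i" for b :: "'i ell2" and i
    by (rule coord_ell2_mult[of _ "cmod l"]) simp
  have bound: "q * (t - \<tau>) \<le> \<bar>q\<bar> * t" if "\<tau> \<in> {0..t}" for q t \<tau> :: real
    using that by (intro order_trans[OF mult_right_mono[OF abs_ge_self] mult_left_mono]) auto
  \<comment> \<open>The product rule for exp (- a t) \<phi>, with \<open>E\<close> and
    \<open>e\<close> standing for exp (- a t) and exp (a t): the shift by \<open>a\<close> in the
    symbol cancels against the derivative of \<open>E\<close>.\<close>
  have rearrange: "E * ((m - l + a) * p + e * n) + - a * E * p = m * (E * p) + (n - l * (E * p))"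
    if "E * e = 1" for E e m l a p n :: complex
  proof -
    have "E * ((m - l + a) * p + e * n) + - a * E * p = m * (E * p) + ((E * e) * n - l * (E * p))"
      by (simp add: algebra_simps)
    then show ?thesis by (simp add: that)
  qed
  have \<psi>c: "continuous_on {0..t} \<psi>" and nc: "continuous_on {0..t} n"
    using \<psi>(2) n t by (auto intro: continuous_on_subset)
  have F: "?F integrable_on {0..t}"
  proof (intro integrable_continuous_interval continuous_on_ell2_exp[OF z(3)])
    show "r * (t - \<tau>) \<le> \<bar>r\<bar> * t" if "\<tau> \<in> {0..t}" for \<tau>
      using that by (rule bound)
    show "continuous_on {0..t} (\<lambda>\<tau>. n \<tau> - ell2_mult (\<lambda>_. l) (\<psi> \<tau>))"
      by (intro continuous_intros nc bounded_linear.continuous_on[OF bounded_linear_ell2_mult[of "\<lambda>_. l" "cmod l"]] \<psi>c) auto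
  qed (auto intro!: continuous_intros)
  have coord_integral: "coord (integral {0..s} f) i = integral {0..s} (\<lambda>\<tau>. coord (f \<tau>) i)"
    if "f integrable_on {0..s}" for f :: "real \<Rightarrow> 'i ell2" and s i
    using integral_linear[OF that bounded_linear_coord[of i]] by (simp add: o_def)
  \<comment> \<open>\<open>\<phi>\<close> need not be differentiable in \<open>ell2\<close> since
    \<open>z\<close> may be unbounded. Each coordinate is, as the solution of a scalar
    equation.\<close>
  have "coord (integral {0..t} ?F) i = coord (\<psi> t - ell2_exp m t x) i" for i
  proof -
    let ?n = "\<lambda>\<tau>. coord (n \<tau>) i"
    have coord_\<phi>: "coord (\<phi> t) i = exp (of_real t * z i) * coord x i
        + integral {0..t} (\<lambda>\<tau>. exp (of_real (t - \<tau>) * z i) * (of_real (exp (a * \<tau>)) * ?n \<tau>))"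
      if t: "t \<in> {0..T}" for t
    proof -
      have "(\<lambda>\<tau>. ell2_exp z (t - \<tau>) (exp (a * \<tau>) *\<^sub>R n \<tau>)) integrable_on {0..t}"
      proof (intro integrable_continuous_interval continuous_on_ell2_exp[OF z(2)])
        show "p * (t - \<tau>) \<le> \<bar>p\<bar> * t" if "\<tau> \<in> {0..t}" for \<tau>
          using that by (rule bound)
        show "continuous_on {0..t} (\<lambda>\<tau>. exp (a * \<tau>) *\<^sub>R n \<tau>)"
          using t by (intro continuous_intros continuous_on_subset[OF n]) auto
      qed (auto intro!: continuous_intros)
      then have "coord (\<phi> t) i = coord (ell2_exp z t x) i
          + integral {0..t} (\<lambda>\<tau>. coord (ell2_exp z (t - \<tau>) (exp (a * \<tau>) *\<^sub>R n \<tau>)) i)"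
        using t by (simp add: \<phi> coord_integral)
      also have "integral {0..t} (\<lambda>\<tau>. coord (ell2_exp z (t - \<tau>) (exp (a * \<tau>) *\<^sub>R n \<tau>)) i)
          = integral {0..t} (\<lambda>\<tau>. exp (of_real (t - \<tau>) * z i) * (of_real (exp (a * \<tau>)) * ?n \<tau>))"
        by (rule integral_cong) (auto simp: coord_ell2_exp[OF z(2)] scaleR_conv_of_real)
      finally show ?thesis
        using t by (simp add: coord_ell2_exp[OF z(2)])
    qed
    have cont: "continuous_on {0..T} (\<lambda>\<tau>. complex_of_real (exp (a * \<tau>)) * ?n \<tau>)"
      by (intro continuous_intros bounded_linear.continuous_on[OF bounded_linear_coord] n)
    have deriv: "((\<lambda>t. coord (\<phi> t) i) has_vector_derivative z i * coord (\<phi> t) i + of_real (exp (a * t)) * ?n t) (at t within {0..T})"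
      if "t \<in> {0..T}" for t
      by (rule duhamel_has_vector_derivative[OF cont that coord_\<phi>])
    have "((\<lambda>t. coord (\<psi> t) i) has_vector_derivative m i * coord (\<psi> t) i + (?n t - l * coord (\<psi> t) i)) (at t within {0..T})"
      if t: "t \<in> {0..T}" for t
    proof -
      have "((\<lambda>t. exp (- a * t)) has_real_derivative - a * exp (- a * t)) (at t within {0..T})"
        by (auto intro!: derivative_eq_intros)
      from has_vector_derivative_of_real[OF this]
      have "((\<lambda>t. of_real (exp (- a * t)) * coord (\<phi> t) i) has_vector_derivative
          of_real (exp (- a * t)) * (z i * coord (\<phi> t) i + of_real (exp (a * t)) * ?n t)
          + of_real (- a * exp (- a * t)) * coord (\<phi> t) i) (at t within {0..T})"
        by (rule has_vector_derivative_mult[OF _ deriv[OF t]])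
      moreover have "(of_real (exp (- a * t)) :: complex) * of_real (exp (a * t)) = 1"
        by (simp flip: of_real_mult exp_add)
      then have "of_real (exp (- a * t)) * (z i * coord (\<phi> t) i + of_real (exp (a * t)) * ?n t)
          + of_real (- a * exp (- a * t)) * coord (\<phi> t) i = m i * coord (\<psi> t) i + (?n t - l * coord (\<psi> t) i)"
        unfolding \<psi>(1) z(1) coord_simps scaleR_conv_of_real of_real_mult of_real_minus by (rule rearrange)
      ultimately show ?thesis
        by (simp add: \<psi>(1) scaleR_conv_of_real)
    qed
    from has_vector_derivative_duhamel[OF this t]
    have "((\<lambda>\<tau>. exp (of_real (t - \<tau>) * m i) * (?n \<tau> - l * coord (\<psi> \<tau>) i)) has_integral
        coord (\<psi> t) i - exp (of_real t * m i) * coord (\<psi> 0) i) {0..t}" .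
    moreover have "\<psi> 0 = x"
      using t by (intro ell2_eqI) (simp add: \<psi>(1) \<phi> coord_ell2_exp[OF z(2)])
    moreover have "coord (integral {0..t} ?F) i = integral {0..t} (\<lambda>\<tau>. exp (of_real (t - \<tau>) * m i) * (?n \<tau> - l * coord (\<psi> \<tau>) i))"
      unfolding coord_integral[OF F]
      by (rule integral_cong) (auto simp: coord_ell2_exp[OF z(3)] coord_l)
    ultimately show ?thesis
      using t by (simp add: integral_unique coord_ell2_exp[OF z(3)])
  qed
  then have "integral {0..t} ?F = \<psi> t - ell2_exp m t x"
    by (rule ell2_eqI)
  then show ?thesis
    using integrable_integral[OF F] by simp
qed

section \<open>Solutions of the damped equation\<close>

context sobolev_algebra
begin

lemma Re_semigroup_symbol_le: "Re (semigroup_symbol V \<nu> k) \<le> V"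
  by (simp add: semigroup_symbol_def)

lemma cgl_semigroup_eq_synth:
  fixes a :: "(int ^ 'd) ell2"
  assumes "\<And>k. fourier_coeff f k = sob_coeff s a k" and t: "0 \<le> t"
  shows "cgl_semigroup V \<nu> t f = synth s (ell2_exp (semigroup_symbol V \<nu>) t a)"
proof
  fix x
  have "exp (of_real t * semigroup_symbol V \<nu> k) * fourier_coeff f k
      = sob_coeff s (ell2_exp (semigroup_symbol V \<nu>) t a) k" for k
    using coord_ell2_exp[of "semigroup_symbol V \<nu>", OF Re_semigroup_symbol_le t, of a k] by (simp add: sob_coeff_def assms(1))
  then show "cgl_semigroup V \<nu> t f x = synth s (ell2_exp (semigroup_symbol V \<nu>) t a) x"
    by (simp add: cgl_semigroup_def synth_def fourier_series_def character_def)
qed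

text \<open>\<open>ell2\<close> carries only real scalars, so the complex factor enters as a
  constant multiplier.\<close>

definition cgl_nonlin :: "nat \<Rightarrow> real \<Rightarrow> (int ^ 'd) ell2 \<Rightarrow> (int ^ 'd) ell2" where
  "cgl_nonlin \<sigma> \<mu> a = ell2_mult (\<lambda>_. - (1 + \<i> * of_real \<mu>)) (sob_power s \<sigma> a)"

lemma cgl_nonlin_zero: "cgl_nonlin \<sigma> \<mu> 0 = 0"
  unfolding cgl_nonlin_def sob_power_zero
  by (rule linear_0[OF bounded_linear.linear[OF bounded_linear_ell2_mult[OF order_refl]]])

lemma cgl_nonlin_lipschitz:
  assumes "0 \<le> M"
  obtains L where "L-lipschitz_on (cball 0 M) (cgl_nonlin \<sigma> \<mu>)"
proof -
  obtain K where K: "K-lipschitz_on (cball 0 M) (sob_power s \<sigma> :: (int ^ 'd) ell2 \<Rightarrow> _)"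
    using sob_power_lipschitz[OF assms] by blast
  let ?c = "- (1 + \<i> * of_real \<mu>) :: complex"
  have "(cmod ?c * K)-lipschitz_on (cball 0 M) (cgl_nonlin \<sigma> \<mu>)"
  proof (rule lipschitz_onI)
    fix a b :: "(int ^ 'd) ell2"
    assume ab: "a \<in> cball 0 M" "b \<in> cball 0 M"
    have "dist (cgl_nonlin \<sigma> \<mu> a) (cgl_nonlin \<sigma> \<mu> b) = norm (ell2_mult (\<lambda>_. ?c) (sob_power s \<sigma> a - sob_power s \<sigma> b))"
      unfolding cgl_nonlin_def dist_norm
      by (subst linear_diff[OF bounded_linear.linear[OF bounded_linear_ell2_mult[OF order_refl]]]) simp
    also have "\<dots> \<le> cmod ?c * norm (sob_power s \<sigma> a - sob_power s \<sigma> b)"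
      by (rule norm_ell2_mult_le) simp
    also have "\<dots> \<le> cmod ?c * (K * norm (a - b))"
      by (intro mult_left_mono lipschitz_on_normD[OF K] ab) auto
    finally show "dist (cgl_nonlin \<sigma> \<mu> a) (cgl_nonlin \<sigma> \<mu> b) \<le> cmod ?c * K * dist a b"
      by (simp add: dist_norm mult.assoc)
  qed (simp add: lipschitz_on_nonneg[OF K])
  then show thesis by (rule that)
qed

lemma cgl_rhs_synth:
  assumes "\<And>x. v \<bullet> Q x = - c"
  shows "cgl_rhs \<sigma> \<mu> R Q v (synth s a)
    = synth s (cgl_nonlin \<sigma> \<mu> a - ell2_mult (\<lambda>_. of_real c * (1 + \<i> * of_real R)) (a :: (int ^ 'd) ell2))"
  by (simp add: fun_eq_iff cgl_rhs_def synth_diff cgl_nonlin_def synth_cmult synth_sob_power assms algebra_simps)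

theorem damped_solution:
  fixes x :: "(int ^ 'd) ell2" and Q :: "real ^ 'd \<Rightarrow> real ^ 'q"
  assumes L: "L-lipschitz_on (cball 0 M) (cgl_nonlin \<sigma> \<mu>)" and M: "2 * norm x \<le> M"
    and a: "0 < a" "2 * L \<le> a" and T: "0 \<le> T"
    and \<psi>\<^sub>0: "\<And>k. fourier_coeff \<psi>\<^sub>0 k = sob_coeff s x k"
    and u: "\<And>x. u \<bullet> Q x = - (V + 2 * a)"
  obtains \<psi> where "mild_solution s \<sigma> V \<nu> \<mu> R Q T (\<lambda>_. u) \<psi>\<^sub>0 \<psi>" "sobolev_norm s (\<psi> T) \<le> exp (- a * T) * M"
proof -
  define l where "l = of_real (V + 2 * a) * (1 + \<i> * of_real R)"
  define m where "m = (semigroup_symbol V \<nu> :: int ^ 'd \<Rightarrow> complex)"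
  \<comment> \<open>The symbol after damping and substitution. Its real part is V - |k|^2 - (V + 2
    a) + a, hence at most - a; \<open>R\<close> contributes to the imaginary part only.\<close>
  define z where "z k = m k - l + of_real a" for k
  have Re_z: "Re (z k) \<le> - a" for k
    by (simp add: z_def m_def l_def semigroup_symbol_def)
  have Re_m: "Re (m k) \<le> V" for k
    unfolding m_def by (rule Re_semigroup_symbol_le)
  interpret decaying_family "ell2_exp z" a
  proof (rule decaying_family.intro)
    show "bounded_linear (ell2_exp z t)" if "0 \<le> t" for t
      by (rule bounded_linear_ell2_exp[OF Re_z that])
    show "norm (ell2_exp z t b) \<le> exp (- a * t) * norm b" if "0 \<le> t" for t b
      by (rule norm_ell2_exp_le[OF Re_z that])
    show "ell2_exp z 0 b = b" for b
      by (intro ell2_eqI) (simp add: coord_ell2_exp[OF Re_z])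
    show "continuous_on ({0..} \<times> UNIV) (\<lambda>(t, b). ell2_exp z t b)"
      unfolding case_prod_unfold
      by (rule continuous_on_ell2_exp[OF Re_z, where B = 0])
        (use a in \<open>auto intro!: continuous_intros mult_nonneg_nonneg\<close>)
  qed (rule a(1))
  \<comment> \<open>The nonlinearity in terms of the rescaled unknown, which is exp (a \<tau>) times
    the solution.\<close>
  define N where "N \<tau> b = exp (a * \<tau>) *\<^sub>R cgl_nonlin \<sigma> \<mu> (exp (- a * \<tau>) *\<^sub>R b)" for \<tau> b
  have M0: "0 \<le> M"
    using M norm_ge_zero[of x] by linarith
  have ball: "exp (- a * \<tau>) *\<^sub>R b \<in> cball 0 M" if "0 \<le> \<tau>" "b \<in> cball 0 M" for \<tau> and b :: "(int ^ 'd) ell2"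
    using that a mult_mono[of "exp (- a * \<tau>)" 1 "norm b" M] by simp
  have nonlin_cont: "continuous_on (cball 0 M) (cgl_nonlin \<sigma> \<mu>)"
    by (rule lipschitz_on_continuous_on[OF L])
  obtain \<phi> where \<phi>: "continuous_on {0..T} \<phi>" "\<And>t. t \<in> {0..T} \<Longrightarrow> norm (\<phi> t) \<le> M"
    "\<And>t. t \<in> {0..T} \<Longrightarrow> \<phi> t = ell2_exp z t x + integral {0..t} (\<lambda>\<tau>. ell2_exp z (t - \<tau>) (N \<tau> (\<phi> \<tau>)))"
  proof (rule duhamel_fixed_point)
    show "continuous_on ({0..T} \<times> cball 0 M) (\<lambda>(t, b). N t b)"
      unfolding N_def case_prod_unfold
      by (intro continuous_intros continuous_on_compose2[OF nonlin_cont] image_subsetI ball) auto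
    show "L-lipschitz_on (cball 0 M) (N t)" if "t \<in> {0..T}" for t
    proof (rule lipschitz_onI)
      fix b c :: "(int ^ 'd) ell2"
      assume "b \<in> cball 0 M" "c \<in> cball 0 M"
      then have "norm (cgl_nonlin \<sigma> \<mu> (exp (- a * t) *\<^sub>R b) - cgl_nonlin \<sigma> \<mu> (exp (- a * t) *\<^sub>R c))
          \<le> L * norm (exp (- a * t) *\<^sub>R b - exp (- a * t) *\<^sub>R c)"
        using that by (intro lipschitz_on_normD[OF L] ball) auto
      also have "\<dots> = exp (- a * t) * (L * norm (b - c))"
        unfolding scaleR_diff_right[symmetric] norm_scaleR by simp
      finally have "exp (a * t) * norm (cgl_nonlin \<sigma> \<mu> (exp (- a * t) *\<^sub>R b) - cgl_nonlin \<sigma> \<mu> (exp (- a * t) *\<^sub>R c))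
          \<le> exp (a * t) * (exp (- a * t) * (L * norm (b - c)))"
        by (intro mult_left_mono) auto
      also have "\<dots> = L * norm (b - c)"
        by (simp add: exp_minus)
      finally show "dist (N t b) (N t c) \<le> L * dist b c"
        unfolding N_def dist_norm scaleR_diff_right[symmetric] norm_scaleR by simp
    qed (rule lipschitz_on_nonneg[OF L])
    show "N t 0 = 0" for t
      by (simp add: N_def cgl_nonlin_zero)
  qed (use a M T in auto)
  define \<psi> where "\<psi> t = exp (- a * t) *\<^sub>R \<phi> t" for t
  have \<psi>_cont: "continuous_on {0..T} \<psi>"
    unfolding \<psi>_def by (intro continuous_intros \<phi>(1))
  have \<psi>_ball: "\<psi> t \<in> cball 0 M" if "t \<in> {0..T}" for t
    unfolding \<psi>_def using that \<phi>(2)[OF that] by (intro ball) auto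
  have nonlin_\<psi>: "continuous_on {0..T} (\<lambda>\<tau>. cgl_nonlin \<sigma> \<mu> (\<psi> \<tau>))"
    by (rule continuous_on_compose2[OF nonlin_cont \<psi>_cont]) (use \<psi>_ball in auto)
  let ?r = "\<lambda>\<tau>. cgl_nonlin \<sigma> \<mu> (\<psi> \<tau>) - ell2_mult (\<lambda>_. l) (\<psi> \<tau>)"
  have r_cont: "continuous_on {0..T} ?r"
    by (intro continuous_intros nonlin_\<psi> bounded_linear.continuous_on[OF bounded_linear_ell2_mult[OF order_refl]] \<psi>_cont)
  \<comment> \<open>By the choice of \<open>N\<close> and \<open>\<psi>\<close>,
    \<open>N \<tau> (\<phi> \<tau>)\<close> equals \<open>exp (a * \<tau>) *\<^sub>R cgl_nonlin
    \<sigma> \<mu> (\<psi> \<tau>)\<close>, the form that the change of generator expects.\<close>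
  have duhamel: "((\<lambda>\<tau>. ell2_exp m (t - \<tau>) (?r \<tau>)) has_integral \<psi> t - ell2_exp m t x) {0..t}"
    if "t \<in> {0..T}" for t
    by (rule duhamel_change_generator[OF z_def Re_z Re_m nonlin_\<psi> _ \<psi>_def \<psi>_cont that])
      (simp add: \<phi>(3) N_def \<psi>_def)
  have "mild_solution s \<sigma> V \<nu> \<mu> R Q T (\<lambda>_. u) \<psi>\<^sub>0 (\<lambda>t. synth s (\<psi> t))"
    unfolding mild_solution_def
  proof (intro conjI ballI)
    have "((\<lambda>r. norm (\<psi> r - \<psi> t)) \<longlongrightarrow> 0) (at t within {0..T})" if "t \<in> {0..T}" for t
      using \<psi>_cont that by (intro tendsto_norm_zero LIM_zero) (simp add: continuous_on_def)
    then show "sobolev_continuous_on s {0..T} (\<lambda>t. synth s (\<psi> t))"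
      by (simp add: sobolev_continuous_on_def synth_in_sobolev sobolev_norm_synth flip: synth_diff)
  next
    fix t
    assume t: "t \<in> {0..T}"
    let ?F = "\<lambda>\<tau>. ell2_exp m (t - \<tau>) (?r \<tau>)"
    have "continuous_on {0..t} ?F"
    proof (rule continuous_on_ell2_exp[OF Re_m])
      show "V * (t - \<tau>) \<le> \<bar>V\<bar> * t" if "\<tau> \<in> {0..t}" for \<tau>
        using that by (intro order_trans[OF mult_right_mono[OF abs_ge_self] mult_left_mono]) auto
    qed (use t in \<open>auto intro!: continuous_intros continuous_on_subset[OF r_cont]\<close>)
    then have int: "has_sobolev_integral s (\<lambda>\<tau>. synth s (?F \<tau>)) (synth s (integral {0..t} ?F)) {0..t}"
      using t by (intro has_sobolev_integral_synth) auto
    have eq: "synth s (integral {0..t} ?F) = (\<lambda>y. synth s (\<psi> t) y - cgl_semigroup V \<nu> t \<psi>\<^sub>0 y)"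
      using t by (simp add: fun_eq_iff integral_unique[OF duhamel[OF t]] synth_diff cgl_semigroup_eq_synth[OF \<psi>\<^sub>0, where V = V and \<nu> = \<nu>, folded m_def])
    have F_eq: "synth s (?F \<tau>) = cgl_semigroup V \<nu> (t - \<tau>) (cgl_rhs \<sigma> \<mu> R Q u (synth s (\<psi> \<tau>)))"
      if "\<tau> \<in> {0..t}" for \<tau>
      using that by (simp add: cgl_rhs_synth[OF u] cgl_semigroup_eq_synth[OF fourier_coeff_synth] l_def m_def)
    show "has_sobolev_integral s (\<lambda>\<tau>. cgl_semigroup V \<nu> (t - \<tau>) (cgl_rhs \<sigma> \<mu> R Q u (synth s (\<psi> \<tau>))))
        (\<lambda>y. synth s (\<psi> t) y - cgl_semigroup V \<nu> t \<psi>\<^sub>0 y) {0..t}"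
      using int by (simp only: eq has_sobolev_integral_cong[OF F_eq])
  qed
  moreover have "sobolev_norm s (synth s (\<psi> T)) \<le> exp (- a * T) * M"
    using \<phi>(2)[of T] T by (simp add: sobolev_norm_synth \<psi>_def)
  ultimately show thesis by (rule that)
qed

end

theorem theorem1p1:
  fixes Q :: "real ^ 'd::{finite,linorder} \<Rightarrow> real ^ 'q"
    and \<sigma> s :: nat
    and V \<nu> \<mu> :: real
  assumes "\<sigma> \<ge> 1"
    and "V \<ge> 0"
    and "torus_fun Q" and "smooth Q"
    and "{\<lambda>x. 1} \<union> (\<Union>k\<in>freqs. {\<lambda>x. sin (x \<bullet> real_vec k), \<lambda>x. cos (x \<bullet> real_vec k)})
           \<subseteq> component_span Q"
    and "s \<ge> crit_index CARD('d)"
  shows "\<forall>R. \<forall>\<epsilon>>0. \<forall>T>0. \<forall>\<psi>\<^sub>0\<in>sobolev s. \<exists>u. L2_control T u \<and>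
           (\<exists>\<psi>. mild_solution s \<sigma> V \<nu> \<mu> R Q T u \<psi>\<^sub>0 \<psi> \<and> sobolev_norm s (\<psi> T) < \<epsilon>)"
proof (intro allI impI ballI)
  fix R \<epsilon> T :: real and \<psi>\<^sub>0 :: "real ^ 'd::{finite,linorder} \<Rightarrow> complex"
  assume "0 < \<epsilon>" "0 < T" "\<psi>\<^sub>0 \<in> sobolev s"
  interpret sobolev_algebra s "TYPE('d)"
    by standard (rule crit_index_less[OF assms(6)])
  obtain x :: "(int ^ 'd::{finite,linorder}) ell2" where x: "\<And>k. fourier_coeff \<psi>\<^sub>0 k = sob_coeff s x k"
    using sobolev_obtain_ell2[OF \<open>\<psi>\<^sub>0 \<in> sobolev s\<close>] by blast
  define M where "M = 2 * norm x"
  have M: "0 \<le> M" by (simp add: M_def)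
  obtain L where L: "L-lipschitz_on (cball 0 M) (cgl_nonlin \<sigma> \<mu> :: (int ^ 'd::{finite,linorder}) ell2 \<Rightarrow> _)"
    using cgl_nonlin_lipschitz[OF M] by blast
  \<comment> \<open>The summand 1 makes \<open>a\<close> positive, \<open>2 * L\<close> yields the
    contraction, and \<open>M / (\<epsilon> * T)\<close> gives M \<le> a T \<epsilon> < exp (a T)
    \<epsilon>, which is the smallness at time \<open>T\<close>.\<close>
  define a where "a = 1 + 2 * L + M / (\<epsilon> * T)"
  have L0: "0 \<le> L" by (rule lipschitz_on_nonneg[OF L])
  have a: "0 < a" "2 * L \<le> a" "M / (\<epsilon> * T) \<le> a"
    using L0 M \<open>0 < \<epsilon>\<close> \<open>0 < T\<close> by (simp_all add: a_def add_pos_nonneg)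
  have "(\<lambda>x. 1) \<in> component_span Q"
    using assms(5) by blast
  then obtain c where c: "\<And>x. 1 = (\<Sum>j\<in>UNIV. c j * Q x $ j)"
    by (auto simp: component_span_def)
  \<comment> \<open>A multiple of the coefficients that express the constant 1; it turns the control
    term into multiplication by - (V + 2 a) (1 + i R).\<close>
  define u where "u = (- (V + 2 * a)) *\<^sub>R (\<chi> j. c j)"
  have u: "u \<bullet> Q x = - (V + 2 * a)" for x
  proof -
    have "u \<bullet> Q x = - (V + 2 * a) * (\<Sum>j\<in>UNIV. c j * Q x $ j)"
      unfolding u_def inner_scaleR_left by (simp add: inner_vec_def)
    then show ?thesis by (simp only: c[symmetric] mult_1_right)
  qed
  obtain \<psi> where \<psi>: "mild_solution s \<sigma> V \<nu> \<mu> R Q T (\<lambda>_. u) \<psi>\<^sub>0 \<psi>" "sobolev_norm s (\<psi> T) \<le> exp (- a * T) * M"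
    by (rule damped_solution[OF L eq_refl[OF M_def[symmetric]] a(1,2) less_imp_le[OF \<open>0 < T\<close>] x u])
  have "M = M / (\<epsilon> * T) * T * \<epsilon>"
    using \<open>0 < \<epsilon>\<close> \<open>0 < T\<close> by simp
  also have "\<dots> \<le> a * T * \<epsilon>"
    using a \<open>0 < \<epsilon>\<close> \<open>0 < T\<close> by (intro mult_right_mono) auto
  also have "\<dots> < exp (a * T) * \<epsilon>"
    using \<open>0 < \<epsilon>\<close> by (intro mult_strict_right_mono less_le_trans[OF _ exp_ge_add_one_self]) auto
  finally have "exp (- a * T) * M < exp (- a * T) * (exp (a * T) * \<epsilon>)"
    by (intro mult_strict_left_mono) auto
  also have "\<dots> = \<epsilon>"
    by (simp add: exp_minus)
  finally have "exp (- a * T) * M < \<epsilon>" .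
  then show "\<exists>u. L2_control T u \<and> (\<exists>\<psi>. mild_solution s \<sigma> V \<nu> \<mu> R Q T u \<psi>\<^sub>0 \<psi> \<and> sobolev_norm s (\<psi> T) < \<epsilon>)"
    using \<psi> L2_control_const by (intro exI[of _ "\<lambda>_. u"] conjI exI[of _ \<psi>]) auto
qed

end
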